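(* Given a Fisher market $\mathcal{M}=\langle [n],[m],\mathcal{V},\mathbf{e}\rangle$ with additive valuations and an equilibrium $(\mathbf{x},\mathbf{p})$ of $\mathcal{M}$, one can find, in strongly polynomial time, a budget vector $\mathbf{e}'=(e'_1,\dots,e'_n)$ and an integral allocation $\mathbf{x}'$ such that: (1) $(\mathbf{x}',\mathbf{p})$ is an integral equilibrium of the Fisher market $\mathcal{M}'=\langle [n],[m],\mathcal{V},\mathbf{e}'\rangle$ (same agents, goods, valuations and prices); (2) $\|\mathbf{e}'-\mathbf{e}\|_\infty\le\|\mathbf{p}\|_\infty$, and in addition $\sum_{i=1}^n e'_i=\sum_{i=1}^n e_i$.
   Context: A Fisher market (with additive valuations) is a tuple $\langle [n],[m],\mathcal{V},\mathbf{e}\rangle$, where $[n]=\{1,\dots,n\}$ is the set of agents, $[m]=\{1,\dots,m\}$ is the set of goods, $\mathbf{e}=(e_1,\dots,e_n)$ with $e_i\in\mathbb{R}_{\ge 0}$ is the budget (endowment) vector, and $\mathcal{V}=\{v_1,\dots,v_n\}$ is the valuation profile: for a bundle $\mathbf{s}\in[0,1]^m$, $v_i(\mathbf{s})=\sum_{j\in[m]}v_{i,j}s_j$, where $v_{i,j}\ge 0$ is the value of agent $i$ for good $j$. An allocation is $\mathbf{x}=(\mathbf{x}_1,\dots,\mathbf{x}_n)\in[0,1]^{n\times m}$ with $\sum_{i\in[n]}x_{i,j}\le 1$ for every good $j$; $\mathbf{x}_i$ is the bundle of agent $i$. It is integral if $\mathbf{x}\in\{0,1\}^{n\times m}$. A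 market outcome is a pair $(\mathbf{x},\mathbf{p})$ of an allocation and a price vector $\mathbf{p}=(p_1,\dots,p_m)\in\mathbb{R}_{\ge 0}^m$. Given $\mathbf{p}$, the maximum bang-per-buck set of agent $i$ is $\mathrm{MBB}_i=\{g\in[m] : v_{i,g}/p_g\ge v_{i,j}/p_j\ \text{for all } j\in[m]\}$. An outcome $(\mathbf{x},\mathbf{p})$ is an equilibrium of $\langle [n],[m],\mathcal{V},\mathbf{e}\rangle$ iff: (market clearing) for each good $g$, either $p_g=0$ or $\sum_{i=1}^n x_{i,g}=1$; (budget exhaustion) $\sum_{g\in[m]}x_{i,g}p_g=e_i$ for every agent $i$; (maximum bang-per-buck allocation) if $x_{i,g}>0$ then $g\in\mathrm{MBB}_i$. An integral equilibrium is an equilibrium $(\mathbf{x},\mathbf{p})$ with $\mathbf{x}$ integral. An algorithm is strongly polynomial time if the number of elementary arithmetic operations and comparisons it performs is polynomial in $n$ and $m$, independently of the magnitudes of the input numbers (and, on rational inputs, it runs in polynomial space). *)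

theory Defs
  imports
    Complex_Main
    "HOL-Library.Extended_Real"
    "HOL-Library.Log_Nat"
    "HOL-Computational_Algebra.Polynomial"
begin

section \<open>Fisher markets\<close>

text \<open>Agents are \<open>0, \<dots>, n - 1\<close> and goods are \<open>0, \<dots>, m - 1\<close>. The functions below are only
  ever consulted inside these ranges. Since valuations are additive, the valuation profile is
  given by the matrix of the values \<open>v\<^sub>i\<^sub>,\<^sub>j\<close>.\<close>

record market =
  agents :: nat
  goods :: nat
  val :: "nat \<Rightarrow> nat \<Rightarrow> real"
  budget :: "nat \<Rightarrow> real"

definition fisher_market :: "market \<Rightarrow> bool" where
  "fisher_market M \<longleftrightarrow>
     (\<forall>i<agents M. 0 \<le> budget M i) \<and>
     (\<forall>i<agents M. \<forall>j<goods M. 0 \<le> val M i j)"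

definition allocation :: "market \<Rightarrow> (nat \<Rightarrow> nat \<Rightarrow> real) \<Rightarrow> bool" where
  "allocation M x \<longleftrightarrow>
     (\<forall>i<agents M. \<forall>j<goods M. x i j \<in> {0..1}) \<and>
     (\<forall>j<goods M. (\<Sum>i<agents M. x i j) \<le> 1)"

definition integral_allocation :: "market \<Rightarrow> (nat \<Rightarrow> nat \<Rightarrow> real) \<Rightarrow> bool" where
  "integral_allocation M x \<longleftrightarrow>
     allocation M x \<and> (\<forall>i<agents M. \<forall>j<goods M. x i j \<in> {0, 1})"

definition market_outcome ::
  "market \<Rightarrow> (nat \<Rightarrow> nat \<Rightarrow> real) \<Rightarrow> (nat \<Rightarrow> real) \<Rightarrow> bool" where
  "market_outcome M x p \<longleftrightarrow> allocation M x \<and> (\<forall>j<goods M. 0 \<le> p j)"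

text \<open>The ratios are taken in the extended reals, so that for a good of price zero the
  bang-per-buck is \<open>\<infinity>\<close> if its value is positive, and \<open>0\<close> if its value is zero. (Division on
  \<^typ>\<open>real\<close> would make it \<open>0\<close> in both cases.)\<close>

definition MBB :: "market \<Rightarrow> (nat \<Rightarrow> real) \<Rightarrow> nat \<Rightarrow> nat set" where
  "MBB M p i = {g. g < goods M \<and>
     (\<forall>j<goods M. ereal (val M i j) / ereal (p j) \<le> ereal (val M i g) / ereal (p g))}"

definition equilibrium ::
  "market \<Rightarrow> (nat \<Rightarrow> nat \<Rightarrow> real) \<Rightarrow> (nat \<Rightarrow> real) \<Rightarrow> bool" where
  "equilibrium M x p \<longleftrightarrow>
     market_outcome M x p \<and>
     (\<forall>g<goods M. p g = 0 \<or> (\<Sum>i<agents M. x i g) = 1) \<and>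
     (\<forall>i<agents M. (\<Sum>g<goods M. x i g * p g) = budget M i) \<and>
     (\<forall>i<agents M. \<forall>g<goods M. 0 < x i g \<longrightarrow> g \<in> MBB M p i)"

definition integral_equilibrium ::
  "market \<Rightarrow> (nat \<Rightarrow> nat \<Rightarrow> real) \<Rightarrow> (nat \<Rightarrow> real) \<Rightarrow> bool" where
  "integral_equilibrium M x p \<longleftrightarrow> equilibrium M x p \<and> integral_allocation M x"

text \<open>The maximum norm of \<open>(u 0, \<dots>, u (k - 1))\<close>, which is \<open>0\<close> for \<open>k = 0\<close>.\<close>

definition sup_norm :: "nat \<Rightarrow> (nat \<Rightarrow> real) \<Rightarrow> real" where
  "sup_norm k u = Max (insert 0 ((\<lambda>i. \<bar>u i\<bar>) ` {..<k}))"


section \<open>A random access machine over the reals\<close>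

text \<open>The machine model for strongly polynomial algorithms: uniform programs that work on
  finitely many named arrays of natural numbers (used for indices and counters) and finitely many
  named arrays of real numbers. Reals can only be added, subtracted, multiplied, divided and
  compared; there is neither rounding nor any other conversion from reals to naturals, and the
  only constants are rational. A scalar variable is an array used at index \<open>0\<close> only.\<close>

record state =
  imem :: "string \<Rightarrow> nat \<Rightarrow> nat"
  rmem :: "string \<Rightarrow> nat \<Rightarrow> real"

datatype iexp =
    IConst nat
  | IGet string iexp
  | IAdd iexp iexp
  | ISub iexp iexp
  | IMul iexp iexp

datatype rexp =
    RConst rat
  | RGet string iexp
  | RAdd rexp rexp
  | RSub rexp rexp
  | RMul rexp rexp
  | RDiv rexp rexp

datatype bexp =
    ILess iexp iexp
  | RLess rexp rexp
  | BNot bexp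
  | BAnd bexp bexp

datatype com =
    Skip
  | ISet string iexp iexp
  | RSet string iexp rexp
  | Seq com com
  | Cond bexp com com
  | While bexp com

text \<open>Subtraction of naturals is truncated, and division by zero yields \<open>0\<close>.\<close>

primrec ival :: "iexp \<Rightarrow> state \<Rightarrow> nat" where
  "ival (IConst k) s = k"
| "ival (IGet a i) s = imem s a (ival i s)"
| "ival (IAdd i j) s = ival i s + ival j s"
| "ival (ISub i j) s = ival i s - ival j s"
| "ival (IMul i j) s = ival i s * ival j s"

primrec rval :: "rexp \<Rightarrow> state \<Rightarrow> real" where
  "rval (RConst q) s = of_rat q"
| "rval (RGet a i) s = rmem s a (ival i s)"
| "rval (RAdd u w) s = rval u s + rval w s"
| "rval (RSub u w) s = rval u s - rval w s"
| "rval (RMul u w) s = rval u s * rval w s"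
| "rval (RDiv u w) s = rval u s / rval w s"

primrec bval :: "bexp \<Rightarrow> state \<Rightarrow> bool" where
  "bval (ILess i j) s \<longleftrightarrow> ival i s < ival j s"
| "bval (RLess u w) s \<longleftrightarrow> rval u s < rval w s"
| "bval (BNot b) s \<longleftrightarrow> \<not> bval b s"
| "bval (BAnd b c) s \<longleftrightarrow> bval b s \<and> bval c s"

text \<open>Time is measured at unit cost: every arithmetic operation, comparison, memory access,
  constant and control step counts \<open>1\<close>, whatever the numbers involved.\<close>

primrec icost :: "iexp \<Rightarrow> nat" where
  "icost (IConst k) = 1"
| "icost (IGet a i) = 1 + icost i"
| "icost (IAdd i j) = 1 + icost i + icost j"
| "icost (ISub i j) = 1 + icost i + icost j"
| "icost (IMul i j) = 1 + icost i + icost j"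

primrec rcost :: "rexp \<Rightarrow> nat" where
  "rcost (RConst q) = 1"
| "rcost (RGet a i) = 1 + icost i"
| "rcost (RAdd u w) = 1 + rcost u + rcost w"
| "rcost (RSub u w) = 1 + rcost u + rcost w"
| "rcost (RMul u w) = 1 + rcost u + rcost w"
| "rcost (RDiv u w) = 1 + rcost u + rcost w"

primrec bcost :: "bexp \<Rightarrow> nat" where
  "bcost (ILess i j) = 1 + icost i + icost j"
| "bcost (RLess u w) = 1 + rcost u + rcost w"
| "bcost (BNot b) = 1 + bcost b"
| "bcost (BAnd b c) = 1 + bcost b + bcost c"

text \<open>Space is measured in bits and is meaningful only for rational data: a rational number takes
  the bits of its numerator and denominator in lowest terms, and a sign. The result of
  \<open>rat_bits\<close> is unspecified on irrational numbers.\<close>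

definition nat_bits :: "nat \<Rightarrow> nat" where
  "nat_bits k = 1 + nat (bitlen (int k))"

definition rat_bits :: "real \<Rightarrow> nat" where
  "rat_bits r = (case quotient_of (inv real_of_rat r) of
     (a, b) \<Rightarrow> 1 + nat (bitlen \<bar>a\<bar>) + nat (bitlen b))"

text \<open>Every nonzero memory cell takes the bits of its index and of its contents. All states of
  interest have finitely many nonzero cells: initial states do, and each assignment changes a
  single cell.\<close>

definition state_bits :: "state \<Rightarrow> nat" where
  "state_bits s =
     (\<Sum>(a, k) \<in> {(a, k). imem s a k \<noteq> 0}. nat_bits k + nat_bits (imem s a k)) +
     (\<Sum>(a, k) \<in> {(a, k). rmem s a k \<noteq> 0}. nat_bits k + rat_bits (rmem s a k))"

definition rational_state :: "state \<Rightarrow> bool" where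
  "rational_state s \<longleftrightarrow> (\<forall>a k. rmem s a k \<in> \<rat>)"

text \<open>The working space for evaluating an expression: the bits of all intermediate results.\<close>

primrec ispace :: "iexp \<Rightarrow> state \<Rightarrow> nat" where
  "ispace (IConst k) s = nat_bits (ival (IConst k) s)"
| "ispace (IGet a i) s = nat_bits (ival (IGet a i) s) + ispace i s"
| "ispace (IAdd i j) s = nat_bits (ival (IAdd i j) s) + ispace i s + ispace j s"
| "ispace (ISub i j) s = nat_bits (ival (ISub i j) s) + ispace i s + ispace j s"
| "ispace (IMul i j) s = nat_bits (ival (IMul i j) s) + ispace i s + ispace j s"

primrec rspace :: "rexp \<Rightarrow> state \<Rightarrow> nat" where
  "rspace (RConst q) s = rat_bits (rval (RConst q) s)"
| "rspace (RGet a i) s = rat_bits (rval (RGet a i) s) + ispace i s"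
| "rspace (RAdd u w) s = rat_bits (rval (RAdd u w) s) + rspace u s + rspace w s"
| "rspace (RSub u w) s = rat_bits (rval (RSub u w) s) + rspace u s + rspace w s"
| "rspace (RMul u w) s = rat_bits (rval (RMul u w) s) + rspace u s + rspace w s"
| "rspace (RDiv u w) s = rat_bits (rval (RDiv u w) s) + rspace u s + rspace w s"

primrec bspace :: "bexp \<Rightarrow> state \<Rightarrow> nat" where
  "bspace (ILess i j) s = 1 + ispace i s + ispace j s"
| "bspace (RLess u w) s = 1 + rspace u s + rspace w s"
| "bspace (BNot b) s = 1 + bspace b s"
| "bspace (BAnd b c) s = 1 + bspace b s + bspace c s"

definition iupd :: "string \<Rightarrow> nat \<Rightarrow> nat \<Rightarrow> state \<Rightarrow> state" where
  "iupd a k c s = s\<lparr>imem := (imem s)(a := (imem s a)(k := c))\<rparr>"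

definition rupd :: "string \<Rightarrow> nat \<Rightarrow> real \<Rightarrow> state \<Rightarrow> state" where
  "rupd a k r s = s\<lparr>rmem := (rmem s)(a := (rmem s a)(k := r))\<rparr>"

text \<open>\<open>exec c s t z s'\<close>: started in state \<open>s\<close>, program \<open>c\<close> terminates in state \<open>s'\<close> after \<open>t\<close>
  unit-cost steps, and the space in use during the run peaks at \<open>z\<close>.\<close>

inductive exec :: "com \<Rightarrow> state \<Rightarrow> nat \<Rightarrow> nat \<Rightarrow> state \<Rightarrow> bool" where
  Skip: "exec Skip s 1 (state_bits s) s"
| ISet: "s' = iupd a (ival i s) (ival j s) s \<Longrightarrow>
    exec (ISet a i j) s (1 + icost i + icost j)
      (max (state_bits s + ispace i s + ispace j s) (state_bits s')) s'"
| RSet: "s' = rupd a (ival i s) (rval u s) s \<Longrightarrow>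
    exec (RSet a i u) s (1 + icost i + rcost u)
      (max (state_bits s + ispace i s + rspace u s) (state_bits s')) s'"
| Seq: "exec c1 s1 t1 z1 s2 \<Longrightarrow> exec c2 s2 t2 z2 s3 \<Longrightarrow>
    exec (Seq c1 c2) s1 (t1 + t2) (max z1 z2) s3"
| CondTrue: "bval b s \<Longrightarrow> exec c1 s t z s' \<Longrightarrow>
    exec (Cond b c1 c2) s (1 + bcost b + t) (max (state_bits s + bspace b s) z) s'"
| CondFalse: "\<not> bval b s \<Longrightarrow> exec c2 s t z s' \<Longrightarrow>
    exec (Cond b c1 c2) s (1 + bcost b + t) (max (state_bits s + bspace b s) z) s'"
| WhileFalse: "\<not> bval b s \<Longrightarrow>
    exec (While b c) s (1 + bcost b) (state_bits s + bspace b s) s"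
| WhileTrue: "bval b s1 \<Longrightarrow> exec c s1 t1 z1 s2 \<Longrightarrow> exec (While b c) s2 t2 z2 s3 \<Longrightarrow>
    exec (While b c) s1 (1 + bcost b + t1 + t2)
      (max (state_bits s1 + bspace b s1) (max z1 z2)) s3"

text \<open>Program \<open>c\<close> solves, in strongly polynomial time, the search problem with instances \<open>D\<close> and
  input-output specification \<open>Q\<close>. Instances are presented to the machine through \<open>enc\<close>, and
  \<open>sz\<close> is the combinatorial size of an instance. The running time is polynomial in \<open>sz\<close> alone;
  on rational inputs the space is moreover polynomial in the total input length. That length
  adds \<open>sz\<close> to the bits of the initial state because zero entries of the input are
  not counted in the latter.\<close>

definition solves_in_strongly_polynomial_time ::
  "com \<Rightarrow> 'i set \<Rightarrow> ('i \<Rightarrow> state) \<Rightarrow> ('i \<Rightarrow> nat) \<Rightarrow> ('i \<Rightarrow> state \<Rightarrow> bool) \<Rightarrow> bool" where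
  "solves_in_strongly_polynomial_time c D enc sz Q \<longleftrightarrow>
     (\<exists>(T :: nat poly) (S :: nat poly). \<forall>I\<in>D. \<exists>t z s.
        exec c (enc I) t z s \<and>
        t \<le> poly T (sz I) \<and>
        (rational_state (enc I) \<longrightarrow> z \<le> poly S (sz I + state_bits (enc I))) \<and>
        Q I s)"


section \<open>Presentation of markets and outcomes to the machine\<close>

text \<open>Matrices with \<open>m\<close> columns are stored row by row: entry \<open>(i, j)\<close> has index \<open>i * m + j\<close>.\<close>

definition vector_array :: "nat \<Rightarrow> (nat \<Rightarrow> real) \<Rightarrow> nat \<Rightarrow> real" where
  "vector_array k u = (\<lambda>l. if l < k then u l else 0)"

definition matrix_array :: "nat \<Rightarrow> nat \<Rightarrow> (nat \<Rightarrow> nat \<Rightarrow> real) \<Rightarrow> nat \<Rightarrow> real" where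
  "matrix_array n m A = (\<lambda>l. if l < n * m then A (l div m) (l mod m) else 0)"

definition input_state ::
  "market \<Rightarrow> (nat \<Rightarrow> nat \<Rightarrow> real) \<Rightarrow> (nat \<Rightarrow> real) \<Rightarrow> state" where
  "input_state M x p =
     \<lparr>imem = (\<lambda>_ _. 0)
        (''n'' := (\<lambda>_. 0)(0 := agents M),
         ''m'' := (\<lambda>_. 0)(0 := goods M)),
      rmem = (\<lambda>_ _. 0)
        (''v'' := matrix_array (agents M) (goods M) (val M),
         ''e'' := vector_array (agents M) (budget M),
         ''x'' := matrix_array (agents M) (goods M) x,
         ''p'' := vector_array (goods M) p)\<rparr>"

definition output_budget :: "state \<Rightarrow> nat \<Rightarrow> real" where
  "output_budget s i = rmem s ''e_out'' i"

definition output_allocation :: "market \<Rightarrow> state \<Rightarrow> nat \<Rightarrow> nat \<Rightarrow> real" where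
  "output_allocation M s i j = rmem s ''x_out'' (i * goods M + j)"

end

theory Submission
  imports Defs
begin

text \<open>Give every good to some agent that holds a positive share of it, and repair the budgets by a
  push-relabel scheme. Agents carry heights, initially 0. While some agent overspends by more than
  the largest price, it gives a good away to an agent exactly one level below that also holds a
  share of this good; if there is none, it is raised by one level. Raised agents never fall below
  their budgets again. Hence no agent rises above height \<open>n\<close>: otherwise some level would be
  vacant, so the goods of the agents above it would be shared among these agents only, who would
  together spend more than their total budget. As goods only move downwards, the number of steps is
  polynomial. Starting again from height 0, the mirror-image scheme repairs underspending: agents
  take goods over instead of giving them away. It creates no overspending, because agents that have
  been raised stay below their budgets and the others only lose goods. All moves stay in the
  support of the given allocation, so bang-per-buck optimality is preserved.

  The scheme needs no multiplication, and an additive program that runs in polynomial time also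
  runs in polynomial space.\<close>

section \<open>Space consumption of additive programs\<close>

text \<open>Two phases are needed because the gap argument is one-sided: it takes a closed set of
  agents none of which deviates negatively while one deviates positively, so only one sign can be
  repaired at a time. An agent is active only with a deviation above \<open>P\<close>, the largest
  price, and a push costs it at most \<open>P\<close>. This is why a raised agent never turns
  negative, and it is the origin of the error bound. A level below \<open>n\<close> is vacant by
  counting: besides an agent at height \<open>n\<close> only \<open>n - 1\<close> others remain.
  Edges descend by at most one level, so none crosses the vacant one. The fractional allocation does
  the accounting: the shares of a good with positive price add up to 1, so the spending of a closed
  set can be compared with its budgets good by good. A good of price 0 may have no holder at all; it
  is then left to a dummy owner. Multiplication would spoil the space bound, as one squaring per
  unit step doubles the number of bits each time.\<close>

primrec additive_iexp :: "iexp \<Rightarrow> bool" where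
  "additive_iexp (IConst k) \<longleftrightarrow> k \<le> 1"
| "additive_iexp (IGet a i) \<longleftrightarrow> additive_iexp i"
| "additive_iexp (IAdd i j) \<longleftrightarrow> additive_iexp i \<and> additive_iexp j"
| "additive_iexp (ISub i j) \<longleftrightarrow> additive_iexp i \<and> additive_iexp j"
| "additive_iexp (IMul i j) \<longleftrightarrow> False"

text \<open>A fractional constant need not be a multiple of 1 / \<open>D\<close> for a denominator
  \<open>D\<close> fixed by the input; 0 and 1 always are.\<close>

primrec additive_rexp :: "rexp \<Rightarrow> bool" where
  "additive_rexp (RConst q) \<longleftrightarrow> q \<in> {0, 1}"
| "additive_rexp (RGet a i) \<longleftrightarrow> additive_iexp i"
| "additive_rexp (RAdd u w) \<longleftrightarrow> additive_rexp u \<and> additive_rexp w"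
| "additive_rexp (RSub u w) \<longleftrightarrow> additive_rexp u \<and> additive_rexp w"
| "additive_rexp (RMul u w) \<longleftrightarrow> False"
| "additive_rexp (RDiv u w) \<longleftrightarrow> False"

primrec additive_bexp :: "bexp \<Rightarrow> bool" where
  "additive_bexp (ILess i j) \<longleftrightarrow> additive_iexp i \<and> additive_iexp j"
| "additive_bexp (RLess u w) \<longleftrightarrow> additive_rexp u \<and> additive_rexp w"
| "additive_bexp (BNot b) \<longleftrightarrow> additive_bexp b"
| "additive_bexp (BAnd b c) \<longleftrightarrow> additive_bexp b \<and> additive_bexp c"

primrec additive :: "com \<Rightarrow> bool" where
  "additive Skip \<longleftrightarrow> True"
| "additive (ISet a i j) \<longleftrightarrow> additive_iexp i \<and> additive_iexp j"
| "additive (RSet a i u) \<longleftrightarrow> additive_iexp i \<and> additive_rexp u"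
| "additive (Seq c d) \<longleftrightarrow> additive c \<and> additive d"
| "additive (Cond b c d) \<longleftrightarrow> additive_bexp b \<and> additive c \<and> additive d"
| "additive (While b c) \<longleftrightarrow> additive_bexp b \<and> additive c"

text \<open>The number is an integer multiple of \<open>1 / D\<close>, the integer having \<open>A\<close> bits. Additions and
  subtractions never leave the multiples of \<open>1 / D\<close>.\<close>

definition fits :: "nat \<Rightarrow> nat \<Rightarrow> real \<Rightarrow> bool" where
  "fits D A r \<longleftrightarrow> (\<exists>z::int. r * real D = of_int z \<and> \<bar>z\<bar> \<le> 2 ^ A)"

definition icells :: "state \<Rightarrow> (string \<times> nat) set" where
  "icells s = {(a, k). imem s a k \<noteq> 0}"

definition rcells :: "state \<Rightarrow> (string \<times> nat) set" where
  "rcells s = {(a, k). rmem s a k \<noteq> 0}"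

text \<open>\<open>K\<close> counts occupied cells, and \<open>A\<close> bounds the bits of
  addresses and contents; addresses matter because \<open>state_bits\<close> charges for them. A run
  of time t adds at most t to \<open>K\<close> and to \<open>A\<close>, while \<open>D\<close> stays
  fixed.\<close>

definition bounded_state :: "nat \<Rightarrow> nat \<Rightarrow> nat \<Rightarrow> state \<Rightarrow> bool" where
  "bounded_state D K A s \<longleftrightarrow>
     finite (icells s) \<and> finite (rcells s) \<and> card (icells s) + card (rcells s) \<le> K \<and>
     (\<forall>a k. (a, k) \<in> icells s \<union> rcells s \<longrightarrow> k \<le> 2 ^ A) \<and>
     (\<forall>a k. imem s a k \<le> 2 ^ A) \<and> (\<forall>a k. fits D A (rmem s a k))"

lemma fits_mono: "fits D A r \<Longrightarrow> A \<le> B \<Longrightarrow> fits D B r"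
  unfolding fits_def
  by (meson order_trans power_increasing one_le_numeral)

lemma bounded_state_mono:
  assumes "bounded_state D K A s" "K \<le> K'" "A \<le> A'"
  shows "bounded_state D K' A' s"
proof -
  have "(2::nat) ^ A \<le> 2 ^ A'" using assms(3) by simp
  then have "k \<le> 2 ^ A'" if "k \<le> 2 ^ A" for k :: nat
    using that by (rule order_trans[rotated])
  moreover have "fits D A' r" if "fits D A r" for r
    using that assms(3) by (rule fits_mono)
  ultimately show ?thesis
    using assms(1,2) unfolding bounded_state_def by auto
qed

section \<open>Bit lengths of integers and of fractions in lowest terms\<close>

lemma nat_bits_le: "k \<le> 2 ^ c \<Longrightarrow> nat_bits k \<le> c + 2"
proof -
  assume "k \<le> 2 ^ c"
  then have "k < 2 ^ (c + 1)" by (rule le_less_trans) simp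
  then have "int k < int (2 ^ (c + 1))" by (simp only: of_nat_less_iff)
  then have "int k < 2 ^ (c + 1)" by simp
  then have "bitlen (int k) \<le> int (c + 1)"
    by (simp only: bitlen_le_iff_power nat_int of_nat_0_le_iff simp_thms)
  then show ?thesis unfolding nat_bits_def by simp
qed

lemma bitlen_int_le: "\<bar>z\<bar> \<le> 2 ^ c \<Longrightarrow> nat (bitlen \<bar>z\<bar>) \<le> c + 1"
  using nat_bits_le[of "nat \<bar>z\<bar>" c] unfolding nat_bits_def
  by (simp add: nat_le_iff)

lemma inv_of_rat [simp]: "inv real_of_rat (real_of_rat q) = q"
  by (simp add: inj_def inv_f_f)

lemma rat_bits_of_rat:
  "quotient_of q = (a, b) \<Longrightarrow> rat_bits (of_rat q) = 1 + nat (bitlen \<bar>a\<bar>) + nat (bitlen b)"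
  by (simp add: rat_bits_def)

lemma of_rat_quotient:
  assumes "quotient_of q = (a, b)"
  shows "real_of_rat q * of_int b = of_int a" "b > 0"
proof -
  show b: "b > 0" using assms quotient_of_denom_pos by blast
  have "q = of_int a / of_int b" using assms quotient_of_div by blast
  then show "real_of_rat q * of_int b = of_int a"
    using b by (simp add: of_rat_divide)
qed

text \<open>Cancelling only shrinks the representation z / \<open>D\<close>: the reduced denominator
  divides \<open>D\<close>, and the same cofactor leads from the reduced numerator to z.\<close>

lemma rat_bits_le:
  assumes "fits D c r" "0 < D" "D \<le> 2 ^ c"
  shows "rat_bits r \<le> 2 * c + 3"
proof -
  obtain z where z: "r * real D = of_int z" "\<bar>z\<bar> \<le> 2 ^ c"
    using assms(1) unfolding fits_def by blast
  define q where "q = rat_of_int z / rat_of_int (int D)"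
  have r: "r = of_rat q"
    using z(1) \<open>0 < D\<close> by (simp add: q_def of_rat_divide field_simps)
  obtain a b where ab: "quotient_of q = (a, b)" by force
  have b: "b > 0" and qa: "real_of_rat q * of_int b = of_int a"
    using of_rat_quotient[OF ab] by auto
  have "real_of_int (a * int D) = real_of_int (z * b)"
    using z(1) qa by (simp add: r) (metis mult.assoc mult.commute)
  then have eq: "a * int D = z * b" by linarith
  have "coprime a b" using ab quotient_of_coprime by blast
  moreover have "b dvd a * int D" using eq by simp
  ultimately have "b dvd int D"
    by (simp add: coprime_commute coprime_dvd_mult_right_iff)
  then obtain k where k: "int D = b * k" by blast
  have "k > 0" using k b \<open>0 < D\<close> by (metis of_nat_0_less_iff zero_less_mult_pos)
  have "z = a * k" using eq k b by simp
  have "\<bar>a\<bar> \<le> \<bar>z\<bar>"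
    using \<open>k > 0\<close> \<open>z = a * k\<close> by (simp add: abs_mult mult_le_cancel_left1)
  then have 1: "nat (bitlen \<bar>a\<bar>) \<le> c + 1"
    using z(2) by (intro bitlen_int_le) linarith
  have "b \<le> int D" using \<open>b dvd int D\<close> \<open>0 < D\<close> zdvd_imp_le by simp
  moreover have "int D \<le> 2 ^ c" using assms(3) by (metis of_nat_le_iff of_nat_numeral of_nat_power)
  ultimately have 2: "nat (bitlen b) \<le> c + 1"
    using bitlen_int_le[of b c] b by linarith
  show ?thesis unfolding r rat_bits_of_rat[OF ab] using 1 2 by simp
qed

section \<open>Working space of expressions\<close>

lemma power_add_le: "(2::'a::linordered_semidom) ^ (A + b) + 2 ^ (A + c) \<le> 2 ^ (A + Suc (b + c))"
proof -
  have "(2::'a) ^ (A + b) \<le> 2 ^ (A + (b + c))" "(2::'a) ^ (A + c) \<le> 2 ^ (A + (b + c))"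
    by (rule power_increasing; simp)+
  then have "(2::'a) ^ (A + b) + 2 ^ (A + c) \<le> 2 ^ (A + (b + c)) + 2 ^ (A + (b + c))"
    by (rule add_mono)
  then show ?thesis by (simp add: mult_2)
qed

text \<open>The cost of an expression is its number of nodes. A sum costs one more than its operands
  together, and this one pays for the carry bit. The space is one intermediate value per
  node.\<close>

lemma iexp_bounds:
  assumes "\<And>a k. imem s a k \<le> 2 ^ A" "additive_iexp i"
  shows "ival i s \<le> 2 ^ (A + icost i) \<and> ispace i s \<le> icost i * (A + icost i + 2)"
  using assms(2)
proof (induction i)
  case (IConst k)
  then have "k \<le> 2 ^ (A + 1)"
    by (metis additive_iexp.simps(1) one_le_numeral one_le_power order_trans)
  then show ?case using nat_bits_le[of k "A + 1"] by simp
next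
  case (IGet a i)
  then have IH: "ispace i s \<le> icost i * (A + icost i + 2)" by simp
  have le: "imem s a (ival i s) \<le> 2 ^ (A + Suc (icost i))"
    using assms(1)[of a "ival i s"] by (rule order_trans) (rule power_increasing; simp)
  have "icost i * (A + icost i + 2) \<le> icost i * (A + Suc (icost i) + 2)" by simp
  then show ?case using nat_bits_le[OF le] le IH by simp
next
  case (IAdd i j)
  then have IH: "ival i s \<le> 2 ^ (A + icost i)" "ival j s \<le> 2 ^ (A + icost j)"
    "ispace i s \<le> icost i * (A + icost i + 2)" "ispace j s \<le> icost j * (A + icost j + 2)" by auto
  have le: "ival i s + ival j s \<le> 2 ^ (A + Suc (icost i + icost j))"
    using power_add_le[where 'a = nat, of A "icost i" "icost j"] IH(1,2) by linarith
  have "icost i * (A + icost i + 2) \<le> icost i * (A + Suc (icost i + icost j) + 2)"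
    "icost j * (A + icost j + 2) \<le> icost j * (A + Suc (icost i + icost j) + 2)"
    by (rule mult_le_mono; simp)+
  then show ?case using nat_bits_le[OF le] le IH(3,4) by (simp add: distrib_right)
next
  case (ISub i j)
  then have IH: "ival i s \<le> 2 ^ (A + icost i)" "ival j s \<le> 2 ^ (A + icost j)"
    "ispace i s \<le> icost i * (A + icost i + 2)" "ispace j s \<le> icost j * (A + icost j + 2)" by auto
  have le: "ival i s - ival j s \<le> 2 ^ (A + Suc (icost i + icost j))"
    using power_add_le[where 'a = nat, of A "icost i" "icost j"] IH(1,2) by linarith
  have "icost i * (A + icost i + 2) \<le> icost i * (A + Suc (icost i + icost j) + 2)"
    "icost j * (A + icost j + 2) \<le> icost j * (A + Suc (icost i + icost j) + 2)"
    by (rule mult_le_mono; simp)+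
  then show ?case using nat_bits_le[OF le] le IH(3,4) by (simp add: distrib_right)
qed simp

text \<open>The induction step shared by sums and differences: \<open>r\<close> stands for the bits
  of the new value, \<open>y\<close> and \<open>w\<close> for the space of the operands.\<close>

lemma space_step:
  fixes A c d :: nat
  assumes "r \<le> 2 * (A + Suc (c + d)) + 3" "y \<le> c * (2 * (A + c) + 3)" "w \<le> d * (2 * (A + d) + 3)"
  shows "r + y + w \<le> Suc (c + d) * (2 * (A + Suc (c + d)) + 3)"
proof -
  define B where "B = 2 * (A + Suc (c + d)) + 3"
  have "c * (2 * (A + c) + 3) \<le> c * B" "d * (2 * (A + d) + 3) \<le> d * B"
    unfolding B_def by (rule mult_le_mono; simp)+
  moreover have "Suc (c + d) * B = B + c * B + d * B" by (simp add: distrib_right)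
  ultimately show ?thesis using assms unfolding B_def[symmetric] by linarith
qed

lemma rexp_bounds:
  assumes s: "\<And>a k. imem s a k \<le> 2 ^ A" "\<And>a k. fits D A (rmem s a k)"
    and D: "0 < D" "D \<le> 2 ^ A" and "additive_rexp u"
  shows "fits D (A + rcost u) (rval u s) \<and> rspace u s \<le> rcost u * (2 * (A + rcost u) + 3)"
  using assms(5)
proof (induction u)
  have D': "D \<le> 2 ^ (A + c)" for c
    using D(2) by (rule order_trans) (rule power_increasing; simp)
  note bits = rat_bits_le[OF _ D(1) D']
  {
    case (RConst q)
    have "int D \<le> 2 ^ (A + 1)" using D'[of 1] by (metis of_nat_le_iff of_nat_numeral of_nat_power)
    then have "fits D (A + 1) (of_rat q)"
      using RConst unfolding fits_def
      by (auto intro: exI[of _ 0] exI[of _ "int D"])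
    then show ?case using bits by fastforce
  next
    case (RGet a i)
    then have IH: "ispace i s \<le> icost i * (A + icost i + 2)" 
      using iexp_bounds[OF s(1)] by simp
    have f: "fits D (A + Suc (icost i)) (rmem s a (ival i s))"
      using s(2) by (rule fits_mono) simp
    have "icost i * (A + icost i + 2) \<le> icost i * (2 * (A + Suc (icost i)) + 3)"
      by (rule mult_le_mono; simp)
    then show ?case using bits[OF f] f IH by simp
  next
    case (RAdd u w)
    then have IH: "fits D (A + rcost u) (rval u s)" "fits D (A + rcost w) (rval w s)"
      "rspace u s \<le> rcost u * (2 * (A + rcost u) + 3)"
      "rspace w s \<le> rcost w * (2 * (A + rcost w) + 3)" by auto
    obtain y z where "rval u s * real D = of_int y" "\<bar>y\<bar> \<le> 2 ^ (A + rcost u)"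
      "rval w s * real D = of_int z" "\<bar>z\<bar> \<le> 2 ^ (A + rcost w)"
      using IH(1,2) unfolding fits_def by blast
    then have f: "fits D (A + Suc (rcost u + rcost w)) (rval u s + rval w s)"
      unfolding fits_def using power_add_le[where 'a = int, of A "rcost u" "rcost w"]
      by (intro exI[of _ "y + z"]) (auto simp: distrib_right)
    show ?case using space_step[OF bits[OF f] IH(3,4)] f by simp
  next
    case (RSub u w)
    then have IH: "fits D (A + rcost u) (rval u s)" "fits D (A + rcost w) (rval w s)"
      "rspace u s \<le> rcost u * (2 * (A + rcost u) + 3)"
      "rspace w s \<le> rcost w * (2 * (A + rcost w) + 3)" by auto
    obtain y z where "rval u s * real D = of_int y" "\<bar>y\<bar> \<le> 2 ^ (A + rcost u)"
      "rval w s * real D = of_int z" "\<bar>z\<bar> \<le> 2 ^ (A + rcost w)"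
      using IH(1,2) unfolding fits_def by blast
    then have f: "fits D (A + Suc (rcost u + rcost w)) (rval u s - rval w s)"
      unfolding fits_def using power_add_le[where 'a = int, of A "rcost u" "rcost w"]
      by (intro exI[of _ "y - z"]) (auto simp: left_diff_distrib)
    show ?case using space_step[OF bits[OF f] IH(3,4)] f by simp
  }
qed simp_all

text \<open>The rate 4 (A + t) + 8 serves for a node of an expression as well as for a memory cell,
  whose address and content take at most (A + 2) + (2 A + 3) bits. With one common rate, memory and
  working space can simply be added in \<open>exec_bounded\<close>.\<close>

lemma space_mono: "(c::nat) * (2 * (A + c) + 3) \<le> c * (4 * (A + d) + 8)" if "c \<le> d"
  using that by (intro mult_le_mono add_mono) auto

lemma ispace_le:
  assumes "bounded_state D K A s" "additive_iexp i" "icost i \<le> t"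
  shows "ispace i s \<le> icost i * (4 * (A + t) + 8)"
proof -
  have "ispace i s \<le> icost i * (A + icost i + 2)"
    using iexp_bounds[OF _ assms(2)] assms(1) by (simp add: bounded_state_def)
  also have "\<dots> \<le> icost i * (4 * (A + t) + 8)" using assms(3) by (intro mult_le_mono) auto
  finally show ?thesis .
qed

lemma rspace_le:
  assumes "bounded_state D K A s" "0 < D" "D \<le> 2 ^ A" "additive_rexp u" "rcost u \<le> t"
  shows "rspace u s \<le> rcost u * (4 * (A + t) + 8)"
proof -
  have "rspace u s \<le> rcost u * (2 * (A + rcost u) + 3)"
    using rexp_bounds[OF _ _ assms(2-4)] assms(1) by (simp add: bounded_state_def)
  also have "\<dots> \<le> rcost u * (4 * (A + t) + 8)" using assms(5) by (rule space_mono)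
  finally show ?thesis .
qed

lemma bspace_le:
  assumes "bounded_state D K A s" "0 < D" "D \<le> 2 ^ A" "additive_bexp b" "bcost b \<le> t"
  shows "bspace b s \<le> bcost b * (4 * (A + t) + 8)"
  using assms(4,5)
proof (induction b)
  case (ILess i j)
  then show ?case
    using ispace_le[OF assms(1), of i t] ispace_le[OF assms(1), of j t] by (simp add: distrib_right)
next
  case (RLess u w)
  then show ?case
    using rspace_le[OF assms(1-3), of u t] rspace_le[OF assms(1-3), of w t]
    by (simp add: distrib_right)
qed (auto simp: distrib_right)

lemma state_bits_le:
  assumes "bounded_state D K A s" "0 < D" "D \<le> 2 ^ A"
  shows "state_bits s \<le> K * (4 * A + 8)"
proof -
  have "nat_bits k + nat_bits (imem s a k) \<le> 4 * A + 8" if "(a, k) \<in> icells s" for a k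
  proof -
    have "k \<le> 2 ^ A" "imem s a k \<le> 2 ^ A"
      using assms(1) that unfolding bounded_state_def by auto
    then show ?thesis using nat_bits_le[of k A] nat_bits_le[of "imem s a k" A] by linarith
  qed
  then have i: "(\<Sum>(a, k) \<in> icells s. nat_bits k + nat_bits (imem s a k))
      \<le> card (icells s) * (4 * A + 8)"
    by (intro sum_bounded_above[where 'a = nat, simplified]) auto
  have "nat_bits k + rat_bits (rmem s a k) \<le> 4 * A + 8" if "(a, k) \<in> rcells s" for a k
  proof -
    have "k \<le> 2 ^ A" "fits D A (rmem s a k)"
      using assms(1) that unfolding bounded_state_def by auto
    then show ?thesis
      using nat_bits_le[of k A] rat_bits_le[of D A "rmem s a k"] assms(2,3) by linarith
  qed
  then have r: "(\<Sum>(a, k) \<in> rcells s. nat_bits k + rat_bits (rmem s a k))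
      \<le> card (rcells s) * (4 * A + 8)"
    by (intro sum_bounded_above[where 'a = nat, simplified]) auto
  have "state_bits s \<le> (card (icells s) + card (rcells s)) * (4 * A + 8)"
    using i r unfolding state_bits_def icells_def[symmetric] rcells_def[symmetric]
    by (simp add: distrib_right)
  also have "\<dots> \<le> K * (4 * A + 8)"
    using assms(1) unfolding bounded_state_def by (intro mult_le_mono1) blast
  finally show ?thesis .
qed

section \<open>Growth of memory along a run\<close>

lemma mem_upd [simp]:
  "imem (iupd a k c s) = (imem s)(a := (imem s a)(k := c))" "rmem (iupd a k c s) = rmem s"
  "rmem (rupd a k r s) = (rmem s)(a := (rmem s a)(k := r))" "imem (rupd a k r s) = imem s"
  by (simp_all add: iupd_def rupd_def)

lemma bounded_state_iupd:
  assumes "bounded_state D K A s" "k \<le> 2 ^ A" "c \<le> 2 ^ A"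
  shows "bounded_state D (Suc K) A (iupd a k c s)"
proof -
  have sub: "icells (iupd a k c s) \<subseteq> insert (a, k) (icells s)"
    "rcells (iupd a k c s) = rcells s"
    by (auto simp: icells_def rcells_def split: if_splits)
  have fin: "finite (icells s)" using assms(1) by (simp add: bounded_state_def)
  have "card (icells (iupd a k c s)) \<le> Suc (card (icells s))"
    using card_mono[OF _ sub(1)] fin by (simp add: card_insert_if split: if_splits)
  moreover have "finite (icells (iupd a k c s))" using fin sub(1) finite_subset by blast
  moreover have "l \<le> 2 ^ A" if "(b, l) \<in> icells (iupd a k c s) \<union> rcells (iupd a k c s)" for b l
    using that sub assms(1,2) unfolding bounded_state_def by blast
  ultimately show ?thesis
    using assms sub(2) unfolding bounded_state_def by auto
qed

lemma bounded_state_rupd: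
  assumes "bounded_state D K A s" "k \<le> 2 ^ A" "fits D A r"
  shows "bounded_state D (Suc K) A (rupd a k r s)"
proof -
  have sub: "rcells (rupd a k r s) \<subseteq> insert (a, k) (rcells s)"
    "icells (rupd a k r s) = icells s"
    by (auto simp: icells_def rcells_def split: if_splits)
  have fin: "finite (rcells s)" using assms(1) by (simp add: bounded_state_def)
  have "card (rcells (rupd a k r s)) \<le> Suc (card (rcells s))"
    using card_mono[OF _ sub(1)] fin by (simp add: card_insert_if split: if_splits)
  moreover have "finite (rcells (rupd a k r s))" using fin sub(1) finite_subset by blast
  moreover have "l \<le> 2 ^ A" if "(b, l) \<in> icells (rupd a k r s) \<union> rcells (rupd a k r s)" for b l
    using that sub assms(1,2) unfolding bounded_state_def by blast
  ultimately show ?thesis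
    using assms sub(2) unfolding bounded_state_def by auto
qed

text \<open>There are K + t slots of 4 (A + t) + 8 bits: K for the cells occupied at the start, and
  one per unit of time, which pays for a node of an expression or for a newly occupied cell.\<close>

lemma exec_bounded:
  assumes "exec c s t z s'" "additive c" "bounded_state D K A s" "0 < D" "D \<le> 2 ^ A"
  shows "bounded_state D (K + t) (A + t) s' \<and> z \<le> (K + t) * (4 * (A + t) + 8)"
  using assms(1,2,3,5)
proof (induction arbitrary: K A rule: exec.induct)
  have bits: "state_bits s + e \<le> (K + t) * (4 * (A + t) + 8)"
    if "bounded_state D K A s" "D \<le> 2 ^ A" "e \<le> t * (4 * (A + t) + 8)" for s K A t e
  proof -
    have "state_bits s \<le> K * (4 * (A + t) + 8)"
      using state_bits_le[OF that(1) \<open>0 < D\<close> that(2)] by (rule order_trans) simp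
    then show ?thesis using that(3) by (simp add: distrib_right)
  qed
  have weaken: "e \<le> c * (4 * (A + t) + 8) \<Longrightarrow> c \<le> t \<Longrightarrow> e \<le> t * (4 * (A + t) + 8)"
    for e c A t :: nat
    by (erule order_trans) simp
  {
    case (Skip s)
    then show ?case using bits[of K A s 0 1] bounded_state_mono by fastforce
  next
    case (ISet s' a i s j)
    let ?t = "1 + icost i + icost j"
    have b: "bounded_state D K (A + ?t) s" using ISet.prems(2) by (rule bounded_state_mono) auto
    have m: "imem s a k \<le> 2 ^ A" for a k using ISet.prems(2) by (simp add: bounded_state_def)
    have "(2::nat) ^ (A + icost i) \<le> 2 ^ (A + ?t)" "(2::nat) ^ (A + icost j) \<le> 2 ^ (A + ?t)"
      by (rule power_increasing; simp)+
    then have "ival i s \<le> 2 ^ (A + ?t)" "ival j s \<le> 2 ^ (A + ?t)"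
      using iexp_bounds[OF m, of i] iexp_bounds[OF m, of j] ISet.prems(1)
      by (auto elim: order_trans)
    then have 1: "bounded_state D (Suc K) (A + ?t) s'"
      unfolding ISet.hyps using b by (intro bounded_state_iupd)
    then have 2: "bounded_state D (K + ?t) (A + ?t) s'" by (rule bounded_state_mono) auto
    have "D \<le> 2 ^ (A + ?t)" using ISet.prems(3) by (rule order_trans) (rule power_increasing; simp)
    then have 3: "state_bits s' \<le> (K + ?t) * (4 * (A + ?t) + 8)"
      using state_bits_le[OF 2 \<open>0 < D\<close>] by simp
    have "ispace i s + ispace j s \<le> ?t * (4 * (A + ?t) + 8)"
      using ispace_le[OF ISet.prems(2), of i ?t] ispace_le[OF ISet.prems(2), of j ?t] ISet.prems(1)
      by (simp add: distrib_right)
    then have "state_bits s + (ispace i s + ispace j s) \<le> (K + ?t) * (4 * (A + ?t) + 8)"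
      by (rule bits[OF ISet.prems(2,3)])
    then show ?case using 2 3 by (simp add: add.assoc)
  next
    case (RSet s' a i s u)
    let ?t = "1 + icost i + rcost u"
    have b: "bounded_state D K (A + ?t) s" using RSet.prems(2) by (rule bounded_state_mono) auto
    have m: "imem s a k \<le> 2 ^ A" "fits D A (rmem s a k)" for a k
      using RSet.prems(2) by (simp_all add: bounded_state_def)
    have "(2::nat) ^ (A + icost i) \<le> 2 ^ (A + ?t)"
      by (rule power_increasing; simp)+
    then have "ival i s \<le> 2 ^ (A + ?t)"
      using iexp_bounds[OF m(1), of i] RSet.prems(1) by (auto elim: order_trans)
    moreover have "fits D (A + ?t) (rval u s)"
    proof (rule fits_mono)
      show "fits D (A + rcost u) (rval u s)"
        using rexp_bounds[OF m \<open>0 < D\<close> RSet.prems(3), of u] RSet.prems(1) by simp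
    qed simp
    ultimately have 1: "bounded_state D (Suc K) (A + ?t) s'"
      unfolding RSet.hyps using b by (intro bounded_state_rupd)
    then have 2: "bounded_state D (K + ?t) (A + ?t) s'" by (rule bounded_state_mono) auto
    have "D \<le> 2 ^ (A + ?t)" using RSet.prems(3) by (rule order_trans) (rule power_increasing; simp)
    then have 3: "state_bits s' \<le> (K + ?t) * (4 * (A + ?t) + 8)"
      using state_bits_le[OF 2 \<open>0 < D\<close>] by simp
    have "ispace i s + rspace u s \<le> ?t * (4 * (A + ?t) + 8)"
      using ispace_le[OF RSet.prems(2), of i ?t] RSet.prems(1)
        rspace_le[OF RSet.prems(2) \<open>0 < D\<close> RSet.prems(3), of u ?t] 
      by (simp add: distrib_right)
    then have "state_bits s + (ispace i s + rspace u s) \<le> (K + ?t) * (4 * (A + ?t) + 8)"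
      by (rule bits[OF RSet.prems(2,3)])
    then show ?case using 2 3 by (simp add: add.assoc)
  next
    case (Seq c1 s1 t1 z1 s2 c2 t2 z2 s3)
    have 1: "bounded_state D (K + t1) (A + t1) s2" "z1 \<le> (K + t1) * (4 * (A + t1) + 8)"
      using Seq.IH(1) Seq.prems by auto
    have "D \<le> 2 ^ (A + t1)" using Seq.prems(3) by (rule order_trans) (rule power_increasing; simp)
    then have 2: "bounded_state D (K + t1 + t2) (A + t1 + t2) s3"
      "z2 \<le> (K + t1 + t2) * (4 * (A + t1 + t2) + 8)"
      using Seq.IH(2)[OF _ 1(1)] Seq.prems by auto
    have "(K + t1) * (4 * (A + t1) + 8) \<le> (K + t1 + t2) * (4 * (A + t1 + t2) + 8)"
      by (intro mult_le_mono; simp)+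
    then show ?case using 1 2 by (simp add: add.assoc)
  next
    case (CondTrue b s c1 t z s' c2)
    let ?t = "1 + bcost b + t"
    have 1: "bounded_state D (K + t) (A + t) s'" "z \<le> (K + t) * (4 * (A + t) + 8)"
      using CondTrue.IH CondTrue.prems by auto
    have "(K + t) * (4 * (A + t) + 8) \<le> (K + ?t) * (4 * (A + ?t) + 8)"
      by (intro mult_le_mono; simp)+
    moreover have "state_bits s + bspace b s \<le> (K + ?t) * (4 * (A + ?t) + 8)"
      using CondTrue.prems \<open>0 < D\<close>
      by (intro bits weaken[OF bspace_le]) auto
    ultimately show ?case using 1 by (auto intro: bounded_state_mono)
  next
    case (CondFalse b s c2 t z s' c1)
    let ?t = "1 + bcost b + t"
    have 1: "bounded_state D (K + t) (A + t) s'" "z \<le> (K + t) * (4 * (A + t) + 8)"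
      using CondFalse.IH CondFalse.prems by auto
    have "(K + t) * (4 * (A + t) + 8) \<le> (K + ?t) * (4 * (A + ?t) + 8)"
      by (intro mult_le_mono; simp)+
    moreover have "state_bits s + bspace b s \<le> (K + ?t) * (4 * (A + ?t) + 8)"
      using CondFalse.prems \<open>0 < D\<close>
      by (intro bits weaken[OF bspace_le]) auto
    ultimately show ?case using 1 by (auto intro: bounded_state_mono)
  next
    case (WhileFalse b s c)
    let ?t = "1 + bcost b"
    have "state_bits s + bspace b s \<le> (K + ?t) * (4 * (A + ?t) + 8)"
      using WhileFalse.prems \<open>0 < D\<close>
      by (intro bits weaken[OF bspace_le]) auto
    then show ?case using WhileFalse.prems by (auto intro: bounded_state_mono)
  next
    case (WhileTrue b s1 c t1 z1 s2 t2 z2 s3)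
    let ?t = "1 + bcost b + t1 + t2"
    have 1: "bounded_state D (K + t1) (A + t1) s2" "z1 \<le> (K + t1) * (4 * (A + t1) + 8)"
      using WhileTrue.IH(1) WhileTrue.prems by auto
    have "D \<le> 2 ^ (A + t1)" using WhileTrue.prems(3) by (rule order_trans) (rule power_increasing; simp)
    then have 2: "bounded_state D (K + t1 + t2) (A + t1 + t2) s3"
      "z2 \<le> (K + t1 + t2) * (4 * (A + t1 + t2) + 8)"
      using WhileTrue.IH(2)[OF _ 1(1)] WhileTrue.prems by auto
    have "(K + t1) * (4 * (A + t1) + 8) \<le> (K + ?t) * (4 * (A + ?t) + 8)"
      "(K + t1 + t2) * (4 * (A + t1 + t2) + 8) \<le> (K + ?t) * (4 * (A + ?t) + 8)"
      by (intro mult_le_mono; simp)+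
    moreover have "state_bits s1 + bspace b s1 \<le> (K + ?t) * (4 * (A + ?t) + 8)"
      using WhileTrue.prems \<open>0 < D\<close>
      by (intro bits weaken[OF bspace_le]) auto
    moreover have "bounded_state D (K + ?t) (A + ?t) s3"
      using 2(1) by (rule bounded_state_mono) auto
    ultimately show ?case using 1 2 by auto
  }
qed

section \<open>Rational input over a common denominator\<close>

lemma le_power_nat_bits: "k \<le> 2 ^ nat_bits k"
proof -
  have "int k < 2 ^ nat (bitlen (int k))"
    using bitlen_bounds[of "int k"] by (cases "k = 0") auto
  also have "\<dots> \<le> 2 ^ nat_bits k" unfolding nat_bits_def by (intro power_increasing) auto
  finally have "int k \<le> int (2 ^ nat_bits k)" by simp
  then show ?thesis by (simp only: of_nat_le_iff)
qed

lemma abs_le_power_bitlen: "\<bar>z\<bar> \<le> 2 ^ nat (bitlen \<bar>z\<bar>)"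
  using bitlen_bounds[of "\<bar>z\<bar>"] by (cases "z = 0") auto

text \<open>\<open>D\<close> is the product of all denominators, whose bit lengths add up to at most
  the length b of the state. Bringing an entry to this denominator multiplies its numerator, at most
  2^b, by a cofactor that is also at most 2^b; hence the doubled exponent.\<close>

lemma bounded_state_initial:
  assumes "finite (icells s)" "finite (rcells s)" "rational_state s"
  shows "\<exists>D. 0 < D \<and> D \<le> 2 ^ (2 * state_bits s) \<and>
    bounded_state D (state_bits s) (2 * state_bits s) s"
proof -
  define b where "b = state_bits s"
  define f where "f = (\<lambda>(a, k). nat_bits k + nat_bits (imem s a k))"
  define g where "g = (\<lambda>(a, k). nat_bits k + rat_bits (rmem s a k))"
  have b: "b = sum f (icells s) + sum g (rcells s)"
    unfolding b_def state_bits_def f_def g_def icells_def rcells_def by simp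
  have ge1: "1 \<le> f y" "1 \<le> g y" for y
    unfolding f_def g_def by (auto simp: nat_bits_def split: prod.splits)
  have card: "card (icells s) + card (rcells s) \<le> b"
    unfolding b card_eq_sum using ge1 by (intro add_mono sum_mono) auto
  have fb: "f y \<le> b" if "y \<in> icells s" for y
    using member_le_sum[OF that, of f] assms(1) unfolding b by simp
  have gb: "g y \<le> b" if "y \<in> rcells s" for y
    using member_le_sum[OF that, of g] assms(2) unfolding b by simp
  have le: "k \<le> 2 ^ c" if "nat_bits k \<le> c" for k c
    using le_power_nat_bits[of k] power_increasing[OF that, of "2::nat"] by linarith
  define q where "q = (\<lambda>(a, k). inv real_of_rat (rmem s a k))"
  have q: "of_rat (q y) = rmem s (fst y) (snd y)" for y
    using assms(3) unfolding q_def rational_state_def Rats_def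
    by (auto simp: f_inv_into_f split: prod.splits)
  define num where "num y = fst (quotient_of (q y))" for y
  define den where "den y = nat (snd (quotient_of (q y)))" for y
  have quot: "quotient_of (q y) = (num y, int (den y))" for y
    unfolding num_def den_def using quotient_of_denom_pos'[of "q y"]
    by (simp add: prod_eq_iff)
  have den: "den y > 0" and numden: "rmem s (fst y) (snd y) * real (den y) = of_int (num y)" for y
    using of_rat_quotient[OF quot[of y]] q[of y] by auto
  have rb: "rat_bits (rmem s (fst y) (snd y)) = 1 + nat (bitlen \<bar>num y\<bar>) + nat (bitlen (int (den y)))" for y
    using rat_bits_of_rat[OF quot[of y]] q[of y] by simp
  define D where "D = (\<Prod>y\<in>rcells s. den y)"
  have D0: "0 < D" unfolding D_def using den by (simp add: prod_pos)
  have den_le: "den y \<le> 2 ^ g y" for y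
  proof -
    have "den y \<le> 2 ^ nat_bits (den y)" by (rule le_power_nat_bits)
    also have "\<dots> \<le> 2 ^ g y"
      unfolding g_def using rb[of y] 
      by (intro power_increasing) (auto simp: nat_bits_def split: prod.splits)
    finally show ?thesis .
  qed
  have "D \<le> (\<Prod>y\<in>rcells s. 2 ^ g y)" unfolding D_def by (intro prod_mono) (auto simp: den_le)
  also have "\<dots> = 2 ^ sum g (rcells s)" by (simp add: power_sum)
  also have "\<dots> \<le> 2 ^ b" by (intro power_increasing) (auto simp: b)
  finally have Db: "D \<le> 2 ^ b" .
  have fits: "fits D (2 * b) (rmem s a k)" for a k
  proof (cases "(a, k) \<in> rcells s")
    case False
    then show ?thesis unfolding fits_def by (auto simp: rcells_def intro: exI[of _ 0])
  next
    case True
    let ?y = "(a, k)"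
    have "den ?y dvd D" unfolding D_def using True assms(2) by (rule dvd_prodI[rotated])
    then obtain l where l: "D = den ?y * l" by blast
    have "l \<le> D" using l D0 by (metis dvd_imp_le dvd_triv_right)
    then have l': "int l \<le> 2 ^ b"
      using Db by (metis (mono_tags, lifting) of_nat_le_iff of_nat_numeral of_nat_power order_trans)
    have "rmem s a k * real D = of_int (num ?y * int l)"
      using numden[of ?y] by (simp add: l mult.assoc[symmetric])
    moreover have "\<bar>num ?y\<bar> \<le> 2 ^ b"
    proof -
      have "nat (bitlen \<bar>num ?y\<bar>) \<le> b" using rb[of ?y] gb[OF True] by (simp add: g_def)
      then have "(2::int) ^ nat (bitlen \<bar>num ?y\<bar>) \<le> 2 ^ b" by (intro power_increasing) auto
      then show ?thesis using abs_le_power_bitlen[of "num ?y"] by linarith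
    qed
    then have "\<bar>num ?y * int l\<bar> \<le> 2 ^ (2 * b)"
      using l' by (simp add: abs_mult mult_2 power_add mult_mono)
    ultimately show ?thesis unfolding fits_def by blast
  qed
  have p: "(2::nat) ^ b \<le> 2 ^ (2 * b)" by (intro power_increasing) auto
  have idx: "k \<le> 2 ^ (2 * b)" if "(a, k) \<in> icells s \<union> rcells s" for a k
    using that fb[of "(a, k)"] gb[of "(a, k)"] by (intro le) (auto simp: f_def g_def)
  have val: "imem s a k \<le> 2 ^ (2 * b)" for a k
  proof (cases "(a, k) \<in> icells s")
    case True
    then show ?thesis using fb[OF True] by (intro le) (auto simp: f_def)
  next
    case False
    then show ?thesis by (simp add: icells_def)
  qed
  have "bounded_state D b (2 * b) s"
    unfolding bounded_state_def using assms card idx val fits by auto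
  moreover have "D \<le> 2 ^ (2 * b)" using Db p by linarith
  ultimately show ?thesis using D0 unfolding b_def by blast
qed

theorem additive_space:
  assumes "additive c" "exec c s t z s'" "finite (icells s)" "finite (rcells s)" "rational_state s"
  shows "z \<le> (state_bits s + t) * (4 * (2 * state_bits s + t) + 8)"
  using bounded_state_initial[OF assms(3-5)] exec_bounded[OF assms(2,1)] by blast

section \<open>Timed execution\<close>

text \<open>Space is forgotten here, since \<open>additive_space\<close> recovers it from the
  running time.\<close>

definition runs :: "com \<Rightarrow> state \<Rightarrow> nat \<Rightarrow> (state \<Rightarrow> bool) \<Rightarrow> bool" where
  "runs c s T Q \<longleftrightarrow> (\<exists>t z s'. exec c s t z s' \<and> t \<le> T \<and> Q s')"

lemma runs_mono: "runs c s T Q \<Longrightarrow> T \<le> T' \<Longrightarrow> (\<And>s. Q s \<Longrightarrow> Q' s) \<Longrightarrow> runs c s T' Q'"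
  unfolding runs_def by (meson order_trans)

lemma runs_Seq:
  assumes "runs c1 s T1 Q" "\<And>s'. Q s' \<Longrightarrow> runs c2 s' T2 Q'"
  shows "runs (Seq c1 c2) s (T1 + T2) Q'"
  using assms unfolding runs_def by (meson add_mono exec.Seq)

lemma runs_Cond:
  assumes "bval b s \<Longrightarrow> runs c1 s T Q" "\<not> bval b s \<Longrightarrow> runs c2 s T Q"
  shows "runs (Cond b c1 c2) s (1 + bcost b + T) Q"
  using assms unfolding runs_def by (meson add_left_mono CondTrue CondFalse)

text \<open>Loop-free code has a functional semantics and a static cost, so loop bodies can be
  verified by simplification.\<close>

primrec straight :: "com \<Rightarrow> bool" where
  "straight Skip \<longleftrightarrow> True"
| "straight (ISet a i j) \<longleftrightarrow> True"
| "straight (RSet a i u) \<longleftrightarrow> True"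
| "straight (Seq c d) \<longleftrightarrow> straight c \<and> straight d"
| "straight (Cond b c d) \<longleftrightarrow> straight c \<and> straight d"
| "straight (While b c) \<longleftrightarrow> False"

text \<open>The values of \<open>step\<close> and \<open>ccost\<close> on loops are junk.\<close>

primrec step :: "com \<Rightarrow> state \<Rightarrow> state" where
  "step Skip s = s"
| "step (ISet a i j) s = iupd a (ival i s) (ival j s) s"
| "step (RSet a i u) s = rupd a (ival i s) (rval u s) s"
| "step (Seq c d) s = step d (step c s)"
| "step (Cond b c d) s = (if bval b s then step c s else step d s)"
| "step (While b c) s = s"

primrec ccost :: "com \<Rightarrow> nat" where
  "ccost Skip = 1"
| "ccost (ISet a i j) = 1 + icost i + icost j"
| "ccost (RSet a i u) = 1 + icost i + rcost u"
| "ccost (Seq c d) = ccost c + ccost d"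
| "ccost (Cond b c d) = 1 + bcost b + (ccost c + ccost d)"
| "ccost (While b c) = 0"

text \<open>\<open>ccost\<close> charges a conditional for both branches, so it bounds the running
  time without being exact.\<close>

lemma runs_straight:
  assumes "straight c" "Q (step c s)"
  shows "runs c s (ccost c) Q"
proof -
  have "runs c s (ccost c) (\<lambda>s'. s' = step c s)" using assms(1)
  proof (induction c arbitrary: s)
    case (Seq c d)
    then show ?case by (auto intro!: runs_Seq)
  next
    case (Cond b c d)
    have "runs c s (ccost c + ccost d) (\<lambda>s'. s' = step c s)"
      "runs d s (ccost c + ccost d) (\<lambda>s'. s' = step d s)"
      using Cond.prems by (auto intro: runs_mono[OF Cond.IH(1)] runs_mono[OF Cond.IH(2)])
    then show ?case
      using runs_Cond[of b s c "ccost c + ccost d" "\<lambda>s'. s' = step (Cond b c d) s" d] by auto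
  next
    case Skip
    show ?case unfolding runs_def by (intro exI conjI, rule exec.Skip) simp_all
  next
    case (ISet a i j)
    show ?case unfolding runs_def by (intro exI conjI, rule exec.ISet[OF refl]) simp_all
  next
    case (RSet a i u)
    show ?case unfolding runs_def by (intro exI conjI, rule exec.RSet[OF refl]) simp_all
  qed simp
  then show ?thesis by (rule runs_mono) (use assms(2) in auto)
qed

lemma runs_step: "Q (step c s) \<Longrightarrow> straight c \<Longrightarrow> ccost c \<le> T \<Longrightarrow> runs c s T Q"
  by (rule runs_mono[OF runs_straight])

section \<open>Counting loops and loops with a decreasing potential\<close>

definition For :: "string \<Rightarrow> string \<Rightarrow> com \<Rightarrow> com" where
  "For v b c = Seq (ISet v (IConst 0) (IConst 0))
     (While (ILess (IGet v (IConst 0)) (IGet b (IConst 0)))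
       (Seq c (ISet v (IConst 0) (IAdd (IGet v (IConst 0)) (IConst 1)))))"

text \<open>Besides its body, an iteration pays 6 for the test and 6 for the increment.
  Initialisation and the last test cost 3 + 6, rounded up to 12.\<close>

definition for_time :: "nat \<Rightarrow> nat \<Rightarrow> nat" where
  "for_time N T = N * (T + 12) + 12"

text \<open>Assumption \<open>counter\<close> makes the invariant blind to the cell of the loop
  variable, so the increment preserves it. \<open>N\<close> is the exact number of iterations; the
  time is stated for any larger \<open>N'\<close>, so that all loops can share the size
  \<open>n + m\<close>.\<close>

lemma runs_For:
  assumes body: "\<And>k s. k < N \<Longrightarrow> I k s \<Longrightarrow> imem s v 0 = k \<Longrightarrow>
      runs c s T (\<lambda>s'. I (Suc k) s' \<and> imem s' v 0 = k)"
    and counter: "\<And>k s l. I k s \<Longrightarrow> I k (iupd v 0 l s)"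
    and bound: "\<And>k s. I k s \<Longrightarrow> imem s b 0 = N"
    and init: "I 0 s" and N': "N \<le> N'"
  shows "runs (For v b c) s (for_time N' T) (I N)"
proof -
  let ?b = "ILess (IGet v (IConst 0)) (IGet b (IConst 0))"
  let ?c = "Seq c (ISet v (IConst 0) (IAdd (IGet v (IConst 0)) (IConst 1)))"
  have loop: "runs (While ?b ?c) s (d * (T + 12) + 6) (I N)"
    if "N - k = d" "k \<le> N" "I k s" "imem s v 0 = k" for k d s
    using that
  proof (induction d arbitrary: k s)
    case 0
    then have "\<not> bval ?b s" using bound[of k s] by simp
    from exec.WhileFalse[OF this, of ?c] show ?case using 0 unfolding runs_def by force
  next
    case (Suc d)
    then have k: "k < N" by simp
    have b: "bval ?b s" using k bound[of k s] Suc.prems by simp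
    have "runs ?c s (T + 6) (\<lambda>s'. I (Suc k) s' \<and> imem s' v 0 = Suc k)"
    proof (rule runs_mono)
      show "runs ?c s (T + ccost (ISet v (IConst 0) (IAdd (IGet v (IConst 0)) (IConst 1))))
          (\<lambda>s'. I (Suc k) s' \<and> imem s' v 0 = Suc k)"
        by (rule runs_Seq, rule body[OF k Suc.prems(3,4)], rule runs_straight)
          (auto intro: counter)
    qed simp_all
    then obtain t z s' where 1: "exec ?c s t z s'" "t \<le> T + 6" "I (Suc k) s'" "imem s' v 0 = Suc k"
      unfolding runs_def by blast
    have "runs (While ?b ?c) s' (d * (T + 12) + 6) (I N)"
      using Suc.IH[of "Suc k" s'] Suc.prems k 1 by simp
    then obtain t' z' s'' where 2: "exec (While ?b ?c) s' t' z' s''" "t' \<le> d * (T + 12) + 6" "I N s''"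
      unfolding runs_def by blast
    show ?case
      using exec.WhileTrue[OF b 1(1) 2(1)] 1(2) 2(2,3) unfolding runs_def by force
  qed
  have main: "runs (For v b c) s (3 + (N * (T + 12) + 6)) (I N)"
    unfolding For_def
  proof (rule runs_Seq)
    show "runs (ISet v (IConst 0) (IConst 0)) s 3 (\<lambda>s'. I 0 s' \<and> imem s' v 0 = 0)"
      using runs_straight[of "ISet v (IConst 0) (IConst 0)" "\<lambda>s'. I 0 s' \<and> imem s' v 0 = 0" s]
        counter[OF init, of 0] by (simp add: numeral_3_eq_3)
  qed (use loop[of 0 N] in auto)
  have "N * (T + 12) \<le> N' * (T + 12)" using N' by (rule mult_le_mono1)
  then have "3 + (N * (T + 12) + 6) \<le> for_time N' T" unfolding for_time_def by linarith
  with main show ?thesis using runs_mono by blast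
qed

text \<open>The potential has to drop only if the loop goes on, so the last iteration is free. This
  allows \<open>F + 1\<close> iterations, and the final test rounds the factor up to
  \<open>F + 2\<close>.\<close>

lemma runs_While:
  fixes f :: "state \<Rightarrow> nat"
  assumes body: "\<And>s. I s \<Longrightarrow> bval b s \<Longrightarrow> runs c s T (\<lambda>s'. I s' \<and> (bval b s' \<longrightarrow> f s' < f s))"
    and "I s" "bval b s \<Longrightarrow> f s \<le> F"
  shows "runs (While b c) s ((F + 2) * (1 + bcost b + T)) (\<lambda>s'. I s' \<and> \<not> bval b s')"
  using assms(2,3)
proof (induction F arbitrary: s rule: less_induct)
  case (less F)
  show ?case
  proof (cases "bval b s")
    case False
    have "1 + bcost b \<le> (F + 2) * (1 + bcost b + T)" by simp
    then show ?thesis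
      using exec.WhileFalse[OF False, of c] False less.prems unfolding runs_def by blast
  next
    case True
    obtain t z s' where 1: "exec c s t z s'" "t \<le> T" "I s'" "bval b s' \<longrightarrow> f s' < f s"
      using body[OF less.prems(1) True] unfolding runs_def by blast
    have "runs (While b c) s' ((F + 1) * (1 + bcost b + T)) (\<lambda>s'. I s' \<and> \<not> bval b s')"
    proof (cases "bval b s'")
      case False
      have "1 + bcost b \<le> (F + 1) * (1 + bcost b + T)" by simp
      then show ?thesis
        using exec.WhileFalse[OF False, of c] False 1(3) unfolding runs_def by blast
    next
      case b: True
      then have "f s' < F" using 1(4) less.prems(2)[OF True] by simp
      then have "F - 1 < F" "f s' \<le> F - 1" "F - 1 + 2 = F + 1" by auto
      then show ?thesis using less.IH[of "F - 1" s'] 1(3) by auto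
    qed
    then obtain t' z' s'' where 2: "exec (While b c) s' t' z' s''"
      "t' \<le> (F + 1) * (1 + bcost b + T)" "I s'' \<and> \<not> bval b s''"
      unfolding runs_def by blast
    have "1 + bcost b + t + t' \<le> (F + 2) * (1 + bcost b + T)"
      using 1(2) 2(2) by (simp add: distrib_right)
    then show ?thesis
      using exec.WhileTrue[OF True 1(1) 2(1)] 2(3) unfolding runs_def by blast
  qed
qed

section \<open>Polynomial time bounds\<close>

definition polynomial :: "(nat \<Rightarrow> nat) \<Rightarrow> bool" where
  "polynomial f \<longleftrightarrow> (\<exists>p. \<forall>x. f x = poly p x)"

lemma polynomial_const [intro, simp]: "polynomial (\<lambda>x. c)"
  unfolding polynomial_def by (intro exI[of _ "[:c:]"]) simp

lemma polynomial_id [intro, simp]: "polynomial (\<lambda>x. x)"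
  unfolding polynomial_def by (intro exI[of _ "[:0, 1:]"]) simp

lemma polynomial_add [intro, simp]:
  "polynomial f \<Longrightarrow> polynomial g \<Longrightarrow> polynomial (\<lambda>x. f x + g x)"
  unfolding polynomial_def by (metis poly_add)

lemma polynomial_mult [intro, simp]:
  "polynomial f \<Longrightarrow> polynomial g \<Longrightarrow> polynomial (\<lambda>x. f x * g x)"
  unfolding polynomial_def by (metis poly_mult)

lemma polynomial_for_time [intro, simp]:
  "polynomial f \<Longrightarrow> polynomial g \<Longrightarrow> polynomial (\<lambda>x. for_time (f x) (g x))"
  unfolding for_time_def by simp

text \<open>The coefficients are natural numbers, hence nonnegative.\<close>

lemma polynomial_mono: "polynomial f \<Longrightarrow> x \<le> y \<Longrightarrow> f x \<le> f y"
  unfolding polynomial_def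
  by (auto simp: poly_altdef intro!: sum_mono mult_left_mono power_mono)

text \<open>An additive program is in polynomial space as soon as it is in polynomial time, since each
  of its steps adds at most one bit to the size of the numbers.\<close>

lemma additive_solves:
  assumes "additive c" "polynomial f"
    and "\<And>I. I \<in> D \<Longrightarrow> finite (icells (enc I)) \<and> finite (rcells (enc I))"
    and "\<And>I. I \<in> D \<Longrightarrow> runs c (enc I) (f (sz I)) (Q I)"
  shows "solves_in_strongly_polynomial_time c D enc sz Q"
proof -
  define g where "g x = (x + f x) * (4 * (2 * x + f x) + 8)" for x
  have "polynomial g" unfolding g_def using assms(2) by simp
  then obtain S T where S: "\<And>x. g x = poly S x" and T: "\<And>x. f x = poly T x"
    using assms(2) unfolding polynomial_def by blast
  have "\<exists>t z s. exec c (enc I) t z s \<and> t \<le> poly T (sz I) \<and>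
      (rational_state (enc I) \<longrightarrow> z \<le> poly S (sz I + state_bits (enc I))) \<and> Q I s"
    if "I \<in> D" for I
  proof -
    obtain t z s where e: "exec c (enc I) t z s" "t \<le> f (sz I)" "Q I s"
      using assms(4)[OF \<open>I \<in> D\<close>] unfolding runs_def by blast
    let ?b = "state_bits (enc I)"
    have "z \<le> g (sz I + ?b)" if "rational_state (enc I)"
    proof -
      have "t \<le> f (sz I + ?b)"
        using e(2) polynomial_mono[OF assms(2), of "sz I" "sz I + ?b"] by simp
      then have "(?b + t) * (4 * (2 * ?b + t) + 8) \<le> g (sz I + ?b)"
        unfolding g_def by (intro mult_le_mono add_mono) auto
      then show ?thesis
        using additive_space[OF assms(1) e(1) _ _ that] assms(3)[OF \<open>I \<in> D\<close>] by simp
    qed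
    then show ?thesis using e S T by metis
  qed
  then show ?thesis unfolding solves_in_strongly_polynomial_time_def by blast
qed

section \<open>Rounding by push and relabel\<close>

text \<open>What rounding sees of an equilibrium: bang-per-buck optimality is a condition on the
  support of \<open>x\<close>, so the valuations are represented by that support.\<close>

locale rounding =
  fixes n m :: nat and x :: "nat \<Rightarrow> nat \<Rightarrow> real" and p e :: "nat \<Rightarrow> real" and P :: real
  assumes x_nonneg: "i < n \<Longrightarrow> j < m \<Longrightarrow> 0 \<le> x i j"
    and p_nonneg: "j < m \<Longrightarrow> 0 \<le> p j"
    and p_le: "j < m \<Longrightarrow> p j \<le> P"
    and P_nonneg: "0 \<le> P"
    and cleared: "j < m \<Longrightarrow> p j = 0 \<or> (\<Sum>i<n. x i j) = 1"
    and spent: "i < n \<Longrightarrow> (\<Sum>j<m. x i j * p j) = e i"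
begin

text \<open>An allocation is given by the owners of the goods; the owner \<open>n\<close> stands for nobody.\<close>

definition spend :: "(nat \<Rightarrow> nat) \<Rightarrow> nat \<Rightarrow> real" where
  "spend ow i = (\<Sum>j<m. if ow j = i then p j else 0)"

text \<open>By market clearing a good of which nobody holds a share has price 0, so leaving it to
  the dummy owner changes no spending.\<close>

definition owned :: "(nat \<Rightarrow> nat) \<Rightarrow> bool" where
  "owned ow \<longleftrightarrow> (\<forall>j<m. ow j < n \<and> 0 < x (ow j) j \<or> ow j = n \<and> p j = 0)"

text \<open>The flag \<open>\<sigma>\<close> tells the phase that repairs overspending from the mirror-image phase that
  repairs underspending.\<close>

definition dev :: "bool \<Rightarrow> (nat \<Rightarrow> nat) \<Rightarrow> nat \<Rightarrow> real" where
  "dev \<sigma> ow i = (if \<sigma> then spend ow i - e i else e i - spend ow i)"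

text \<open>An edge hands deviation from \<open>u\<close> to \<open>w\<close>: depending on the phase, \<open>u\<close> gives the good \<open>j\<close> to
  \<open>w\<close> or takes it from \<open>w\<close>.\<close>

definition edge :: "bool \<Rightarrow> (nat \<Rightarrow> nat) \<Rightarrow> nat \<Rightarrow> nat \<Rightarrow> nat \<Rightarrow> bool" where
  "edge \<sigma> ow u j w \<longleftrightarrow> (if \<sigma> then ow j = u \<and> 0 < x w j else ow j = w \<and> 0 < x u j)"

definition admissible ::
  "bool \<Rightarrow> (nat \<Rightarrow> nat) \<Rightarrow> (nat \<Rightarrow> nat) \<Rightarrow> nat \<Rightarrow> nat \<Rightarrow> nat \<Rightarrow> bool" where
  "admissible \<sigma> ow h u j w \<longleftrightarrow> edge \<sigma> ow u j w \<and> h u = Suc (h w)"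

text \<open>The condition on edges is the valid labelling of push-relabel algorithms. The last
  conjunct binds only the second phase, where it says that nobody overspends by more than
  \<open>P\<close>; in the first phase underspending is unrestricted. \<open>d\<close> is a stored
  copy of the deviations, which pushes update instead of summing anew.\<close>

definition labelling :: "bool \<Rightarrow> (nat \<Rightarrow> nat) \<Rightarrow> (nat \<Rightarrow> nat) \<Rightarrow> (nat \<Rightarrow> real) \<Rightarrow> bool" where
  "labelling \<sigma> ow h d \<longleftrightarrow>
     owned ow \<and>
     (\<forall>i<n. d i = dev \<sigma> ow i) \<and>
     (\<forall>u<n. \<forall>w<n. \<forall>j<m. edge \<sigma> ow u j w \<longrightarrow> h u \<le> Suc (h w)) \<and>
     (\<forall>i<n. h i \<le> n) \<and>
     (\<forall>i<n. 0 < h i \<longrightarrow> 0 \<le> d i) \<and>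
     (\<forall>i<n. \<sigma> \<or> - P \<le> d i)"

text \<open>A push lowers the second summand; a relabelling lowers the first one by at least \<open>m + 1\<close> and
  raises the second one by at most \<open>m\<close>.\<close>

definition pot :: "bool \<Rightarrow> (nat \<Rightarrow> nat) \<Rightarrow> (nat \<Rightarrow> nat) \<Rightarrow> nat" where
  "pot \<sigma> ow h = Suc m * (\<Sum>i<n. n - h i) +
     (\<Sum>j<m. if ow j < n then if \<sigma> then h (ow j) else n - h (ow j) else 0)"

lemma pot_le:
  assumes "labelling \<sigma> ow h d"
  shows "pot \<sigma> ow h \<le> Suc m * (n * n) + m * n"
proof -
  have "(\<Sum>i<n. n - h i) \<le> card {..<n} * n" by (rule sum_bounded_above[where 'a = nat, simplified]) simp
  moreover have "(\<Sum>j<m. if ow j < n then if \<sigma> then h (ow j) else n - h (ow j) else 0) \<le> card {..<m} * n"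
    using assms by (intro sum_bounded_above[where 'a = nat, simplified]) (simp add: labelling_def)
  ultimately show ?thesis unfolding pot_def by (intro add_mono mult_le_mono) simp_all
qed

section \<open>Pushes\<close>

lemma sum_remove_at: "j < m \<Longrightarrow> (\<Sum>j<m. f j) = f j + (\<Sum>j\<in>{..<m} - {j}. f j)" for f :: "nat \<Rightarrow> real"
  by (simp add: sum.remove)

lemma spend_move:
  assumes "j < m" "ow j = a" "a \<noteq> b"
  shows "spend (ow(j := b)) i
    = spend ow i - (if i = a then p j else 0) + (if i = b then p j else 0)"
proof -
  have "(\<Sum>l\<in>{..<m} - {j}. if (ow(j := b)) l = i then p l else 0)
      = (\<Sum>l\<in>{..<m} - {j}. if ow l = i then p l else 0)"
    by (rule sum.cong) auto
  then show ?thesis using assms unfolding spend_def sum_remove_at[OF assms(1)] by auto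
qed

text \<open>Only \<open>u\<close> loses deviation, and it falls from above \<open>P\<close> by at
  most \<open>P\<close>; this preserves all lower bounds. The only new edges are those over
  \<open>j\<close>. The good goes down in the first phase and up in the second, in both cases
  towards a smaller term of \<open>pot\<close>.\<close>

lemma labelling_move:
  fixes ow h d u w j \<sigma>
  defines "ow' \<equiv> ow(j := if \<sigma> then w else u)"
    and "d' \<equiv> d(u := d u - p j, w := d w + p j)"
  assumes labelling: "labelling \<sigma> ow h d" and lt: "u < n" "w < n" "j < m"
    and act: "P < d u" and adm: "admissible \<sigma> ow h u j w"
  shows "labelling \<sigma> ow' h d'" "pot \<sigma> ow' h < pot \<sigma> ow h"
proof -
  have e: "edge \<sigma> ow u j w" and h: "h u = Suc (h w)" using adm by (auto simp: admissible_def)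
  have ne: "u \<noteq> w" using h by auto
  have dev': "d' i = dev \<sigma> ow' i" if "i < n" for i
  proof -
    have "d i = dev \<sigma> ow i" using labelling that by (simp add: labelling_def)
    moreover have "spend ow' i = spend ow i
        - (if i = (if \<sigma> then u else w) then p j else 0) + (if i = (if \<sigma> then w else u) then p j else 0)"
      using e ne unfolding ow'_def edge_def by (intro spend_move lt(3)) (auto split: if_splits)
    ultimately show ?thesis using ne by (auto simp: dev_def d'_def)
  qed
  have own': "owned ow'"
    using labelling e lt unfolding labelling_def owned_def ow'_def edge_def by (auto split: if_splits)
  have old: "h a \<le> Suc (h b)" if "a < n" "b < n" "l < m" "edge \<sigma> ow a l b" for a b l
    using labelling that by (simp add: labelling_def)
  have edge': "h a \<le> Suc (h b)" if "a < n" "b < n" "l < m" "edge \<sigma> ow' a l b" for a b l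
  proof (cases "l = j")
    case False
    then show ?thesis using that old[of a b l] by (auto simp: edge_def ow'_def split: if_splits)
  next
    case True
    show ?thesis
    proof (cases \<sigma>)
      case s: True
      \<comment> \<open>A new edge leaves \<open>w\<close> for a holder of a share of
        \<open>j\<close>. There was such an edge from \<open>u\<close>, and \<open>w\<close> is
        lower than \<open>u\<close>.\<close>
      then have "a = w" "edge \<sigma> ow u j b" using that(4) True e by (auto simp: edge_def ow'_def)
      then show ?thesis using old[of u b j] that lt h by simp
    next
      case s: False
      \<comment> \<open>A new edge enters \<open>u\<close> from a holder of a share of
        \<open>j\<close>. There was such an edge into \<open>w\<close>, and \<open>u\<close> is
        higher than \<open>w\<close>.\<close>
      then have "b = u" "edge \<sigma> ow a j w" using that(4) True e by (auto simp: edge_def ow'_def)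
      then show ?thesis using old[of a w j] that lt h by simp
    qed
  qed
  have du: "0 \<le> d' u" using act p_le[OF lt(3)] ne by (simp add: d'_def)
  have di: "d i \<le> d' i" if "i \<noteq> u" for i using that p_nonneg[OF lt(3)] by (simp add: d'_def)
  have ge0: "0 \<le> d' i" if "i < n" "0 < h i" for i
  proof (cases "i = u")
    case False
    have "0 \<le> d i" using labelling that unfolding labelling_def by blast
    then show ?thesis using di[OF False] by linarith
  qed (use du in simp)
  have low: "\<sigma> \<or> - P \<le> d' i" if "i < n" for i
  proof (cases "i = u")
    case False
    have "\<sigma> \<or> - P \<le> d i" using labelling that unfolding labelling_def by blast
    then show ?thesis using di[OF False] by linarith
  qed (use du P_nonneg in simp)
  have hn: "h i \<le> n" if "i < n" for i using labelling that by (simp add: labelling_def)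
  show "labelling \<sigma> ow' h d'"
    unfolding labelling_def by (intro conjI allI impI own' dev' edge' ge0 low hn)
  \<comment> \<open>Keeps the truncated subtraction honest: in the second phase
    \<open>n - h u < n - h w\<close> has to hold.\<close>
  have "h u \<le> n" using labelling lt by (simp add: labelling_def)
  have "(\<Sum>l<m. if ow' l < n then if \<sigma> then h (ow' l) else n - h (ow' l) else 0)
      < (\<Sum>l<m. if ow l < n then if \<sigma> then h (ow l) else n - h (ow l) else 0)"
  proof (rule sum_strict_mono_ex1)
    have *: "(if ow' j < n then if \<sigma> then h (ow' j) else n - h (ow' j) else 0)
        < (if ow j < n then if \<sigma> then h (ow j) else n - h (ow j) else 0)"
      using e h \<open>h u \<le> n\<close> lt by (auto simp: edge_def ow'_def)
    then show "\<exists>l\<in>{..<m}. (if ow' l < n then if \<sigma> then h (ow' l) else n - h (ow' l) else 0)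
        < (if ow l < n then if \<sigma> then h (ow l) else n - h (ow l) else 0)"
      using lt(3) by blast
    show "\<forall>l\<in>{..<m}. (if ow' l < n then if \<sigma> then h (ow' l) else n - h (ow' l) else 0)
        \<le> (if ow l < n then if \<sigma> then h (ow l) else n - h (ow l) else 0)"
    proof
      fix l show "(if ow' l < n then if \<sigma> then h (ow' l) else n - h (ow' l) else 0)
        \<le> (if ow l < n then if \<sigma> then h (ow l) else n - h (ow l) else 0)"
        using * by (cases "l = j") (auto simp: ow'_def)
    qed
  qed simp
  then show "pot \<sigma> ow' h < pot \<sigma> ow h" by (simp add: pot_def)
qed

text \<open>Agents outside a closed set of agents cannot absorb any of its surplus.\<close>

lemma closed_dev_le:
  assumes labelling: "labelling \<sigma> ow h d" and R: "R \<subseteq> {..<n}"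
    and closed: "\<And>u j w. u \<in> R \<Longrightarrow> j < m \<Longrightarrow> w < n \<Longrightarrow> edge \<sigma> ow u j w \<Longrightarrow> w \<in> R"
  shows "(\<Sum>i\<in>R. d i) \<le> 0"
proof -
  have fin: "finite R" using R finite_subset by blast
  have lt: "i < n" if "i \<in> R" for i using R that by auto
  have "(\<Sum>i\<in>R. spend ow i) = (\<Sum>j<m. \<Sum>i\<in>R. if ow j = i then p j else 0)"
    unfolding spend_def by (rule sum.swap)
  also have "\<dots> = (\<Sum>j<m. if ow j \<in> R then p j else 0)"
    using fin by (intro sum.cong) auto
  finally have S: "(\<Sum>i\<in>R. spend ow i) = (\<Sum>j<m. if ow j \<in> R then p j else 0)" .
  have "(\<Sum>i\<in>R. e i) = (\<Sum>i\<in>R. \<Sum>j<m. x i j * p j)"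
    using lt by (intro sum.cong) (simp_all add: spent)
  also have "\<dots> = (\<Sum>j<m. \<Sum>i\<in>R. x i j * p j)" by (rule sum.swap)
  finally have E: "(\<Sum>i\<in>R. e i) = (\<Sum>j<m. \<Sum>i\<in>R. x i j * p j)" .
  have own: "ow j < n \<and> 0 < x (ow j) j \<or> p j = 0" if "j < m" for j
    using labelling that unfolding labelling_def owned_def by blast
  have le: "(\<Sum>i\<in>R. x i j * p j) \<le> p j" if j: "j < m" for j
  proof (cases "p j = 0")
    case False
    have "(\<Sum>i\<in>R. x i j) \<le> (\<Sum>i<n. x i j)" using R j by (intro sum_mono2) (auto intro: x_nonneg)
    also have "\<dots> = 1" using cleared[OF j] False by simp
    finally have "(\<Sum>i\<in>R. x i j) * p j \<le> 1 * p j" using p_nonneg[OF j] by (rule mult_right_mono)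
    then show ?thesis by (simp add: sum_distrib_right)
  qed simp
  have ge0: "0 \<le> (\<Sum>i\<in>R. x i j * p j)" if j: "j < m" for j
    using lt j by (intro sum_nonneg mult_nonneg_nonneg x_nonneg p_nonneg) auto
  show ?thesis
  proof (cases \<sigma>)
    case True
    have "(\<Sum>j<m. if ow j \<in> R then p j else 0) \<le> (\<Sum>j<m. \<Sum>i\<in>R. x i j * p j)"
    proof (rule sum_mono)
      fix j assume "j \<in> {..<m}"
      then have j: "j < m" by simp
      show "(if ow j \<in> R then p j else 0) \<le> (\<Sum>i\<in>R. x i j * p j)"
      proof (cases "ow j \<in> R \<and> p j \<noteq> 0")
        case r: True
        \<comment> \<open>Every holder of a share of \<open>j\<close> is reached by an edge from its
          owner. So \<open>R\<close> holds all shares, and its budgets cover the full price.\<close>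
        have "x i j = 0" if "i < n" "i \<notin> R" for i
          using closed[of "ow j" j i] r that j x_nonneg[of i j] True by (force simp: edge_def)
        then have "(\<Sum>i\<in>R. x i j) = (\<Sum>i<n. x i j)"
          using R by (intro sum.mono_neutral_left) auto
        also have "\<dots> = 1" using cleared[OF j] r by simp
        finally show ?thesis using r by (simp add: sum_distrib_right[symmetric])
      qed (use ge0[OF j] in auto)
    qed
    then have "(\<Sum>i\<in>R. spend ow i) - (\<Sum>i\<in>R. e i) \<le> 0" unfolding S E by simp
    moreover have "(\<Sum>i\<in>R. d i) = (\<Sum>i\<in>R. spend ow i - e i)"
      using labelling lt True by (intro sum.cong) (auto simp: labelling_def dev_def)
    ultimately show ?thesis by (simp add: sum_subtractf)
  next
    case False
    have "(\<Sum>j<m. \<Sum>i\<in>R. x i j * p j) \<le> (\<Sum>j<m. if ow j \<in> R then p j else 0)"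
    proof (rule sum_mono)
      fix j assume "j \<in> {..<m}"
      then have j: "j < m" by simp
      show "(\<Sum>i\<in>R. x i j * p j) \<le> (if ow j \<in> R then p j else 0)"
      proof (cases "ow j \<in> R \<or> p j = 0")
        case r: False
        \<comment> \<open>A share of \<open>j\<close> inside \<open>R\<close> would give an edge to
          the owner of \<open>j\<close>, an agent since \<open>p j\<close> is positive, and so put
          the owner into \<open>R\<close>.\<close>
        have "x i j = 0" if "i \<in> R" for i
          using closed[of i j "ow j"] r that j x_nonneg[OF lt[OF that] j] own[OF j] False
          by (force simp: edge_def)
        then show ?thesis using r by simp
      qed (use le[OF j] in auto)
    qed
    then have "(\<Sum>i\<in>R. e i) - (\<Sum>i\<in>R. spend ow i) \<le> 0" unfolding S E by simp
    moreover have "(\<Sum>i\<in>R. d i) = (\<Sum>i\<in>R. e i - spend ow i)"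
      using labelling lt False by (intro sum.cong) (auto simp: labelling_def dev_def)
    ultimately show ?thesis by (simp add: sum_subtractf)
  qed
qed

text \<open>The gap argument: if an active agent were at height \<open>n\<close>, some height below would be vacant,
  and the agents above it would form a closed set of positive surplus.\<close>

lemma active_height:
  assumes labelling: "labelling \<sigma> ow h d" and u: "u < n" "P < d u"
  shows "h u < n"
proof (rule ccontr)
  assume "\<not> h u < n"
  have "\<not> {..<n} \<subseteq> h ` ({..<n} - {u})"
  proof
    assume "{..<n} \<subseteq> h ` ({..<n} - {u})"
    then have "card {..<n} \<le> card ({..<n} - {u})" by (intro surj_card_le) auto
    then show False using u(1) by simp
  qed
  then obtain l where l: "l < n" "l \<notin> h ` ({..<n} - {u})" by blast
  define R where "R = {i. i < n \<and> l < h i}"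
  have uR: "u \<in> R" using u(1) l(1) \<open>\<not> h u < n\<close> by (simp add: R_def)
  have "w \<in> R" if "a \<in> R" "j < m" "w < n" "edge \<sigma> ow a j w" for a j w
  proof (cases "w = u")
    case False
    have "h a \<le> Suc (h w)" using labelling that by (auto simp: labelling_def R_def)
    moreover have "h w \<noteq> l" using l(2) that(3) False by blast
    ultimately show ?thesis using that by (auto simp: R_def)
  qed (use uR in simp)
  then have "(\<Sum>i\<in>R. d i) \<le> 0" by (intro closed_dev_le[OF labelling]) (auto simp: R_def)
  moreover have "0 < (\<Sum>i\<in>R. d i)"
  proof (rule sum_pos2[OF _ uR])
    show "0 < d u" using u(2) P_nonneg by linarith
    show "0 \<le> d i" if "i \<in> R" for i using labelling that by (auto simp: labelling_def R_def)
  qed (simp add: R_def)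
  ultimately show False by linarith
qed

text \<open>With no admissible edge, all edges out of \<open>u\<close> end at height
  \<open>h u\<close> or above, so \<open>u\<close> may rise by one; the constraints on edges into
  \<open>u\<close> only weaken. \<open>active_height\<close> keeps the new height within
  \<open>n\<close>.\<close>

lemma labelling_relabel:
  assumes labelling: "labelling \<sigma> ow h d" and u: "u < n" "P < d u"
    and stuck: "\<And>j w. j < m \<Longrightarrow> w < n \<Longrightarrow> \<not> admissible \<sigma> ow h u j w"
  shows "labelling \<sigma> ow (h(u := Suc (h u))) d" "pot \<sigma> ow (h(u := Suc (h u))) < pot \<sigma> ow h"
proof -
  let ?h = "h(u := Suc (h u))"
  have hu: "h u < n" by (rule active_height[OF labelling u])
  have "?h a \<le> Suc (?h b)" if "a < n" "b < n" "j < m" "edge \<sigma> ow a j b" for a b j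
  proof -
    have "h a \<le> Suc (h b)" using labelling that by (simp add: labelling_def)
    moreover have "a = u \<Longrightarrow> h a \<noteq> Suc (h b)" using stuck that by (auto simp: admissible_def)
    ultimately show ?thesis by auto
  qed
  moreover have "0 \<le> d u" using u(2) P_nonneg by linarith
  ultimately show "labelling \<sigma> ow ?h d" using labelling hu unfolding labelling_def by auto
  have "(\<Sum>i<n. n - ?h i) < (\<Sum>i<n. n - h i)"
  proof (rule sum_strict_mono_ex1)
    show "\<exists>i\<in>{..<n}. n - ?h i < n - h i" using u(1) hu by (intro bexI[of _ u]) auto
  qed auto
  then have "Suc m * Suc (\<Sum>i<n. n - ?h i) \<le> Suc m * (\<Sum>i<n. n - h i)"
    by (intro mult_le_mono2) simp
  moreover have "(\<Sum>j<m. if ow j < n then if \<sigma> then ?h (ow j) else n - ?h (ow j) else 0)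
      \<le> (\<Sum>j<m. (if ow j < n then if \<sigma> then h (ow j) else n - h (ow j) else 0) + 1)"
    by (intro sum_mono) auto
  ultimately show "pot \<sigma> ow ?h < pot \<sigma> ow h" unfolding pot_def sum.distrib by simp
qed

text \<open>Invariant of the search for pushes from \<open>u\<close>, which has dealt with the pairs of a good and an
  agent up to \<open>(j, k)\<close> in lexicographic order.\<close>

definition scan :: "bool \<Rightarrow> nat \<Rightarrow> nat \<Rightarrow> nat \<Rightarrow> nat \<Rightarrow>
    (nat \<Rightarrow> nat) \<Rightarrow> (nat \<Rightarrow> nat) \<Rightarrow> (nat \<Rightarrow> real) \<Rightarrow> bool" where
  "scan \<sigma> B u j k ow h d \<longleftrightarrow>
     labelling \<sigma> ow h d \<and> pot \<sigma> ow h \<le> B \<and> (d u \<le> P \<longrightarrow> pot \<sigma> ow h < B) \<and>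
     (\<forall>j' k'. j' < m \<longrightarrow> k' < n \<longrightarrow> j' < j \<or> j' = j \<and> k' < k \<longrightarrow> P < d u \<longrightarrow>
        \<not> admissible \<sigma> ow h u j' k')"

lemma scan_start: "labelling \<sigma> ow h d \<Longrightarrow> pot \<sigma> ow h \<le> B \<Longrightarrow> P < d u \<Longrightarrow> scan \<sigma> B u 0 0 ow h d"
  by (simp add: scan_def)

lemma scan_row: "scan \<sigma> B u j n ow h d \<Longrightarrow> scan \<sigma> B u (Suc j) 0 ow h d"
  unfolding scan_def by (auto simp: less_Suc_eq)

lemma scan_skip:
  "scan \<sigma> B u j k ow h d \<Longrightarrow> \<not> (P < d u \<and> admissible \<sigma> ow h u j k) \<Longrightarrow> scan \<sigma> B u j (Suc k) ow h d"
  unfolding scan_def by (auto simp: less_Suc_eq)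

text \<open>This is why one pass over the pairs suffices. Heights are fixed during a scan, and a
  push changes the owner of \<open>j\<close> only. Afterwards no edge over \<open>j\<close> is
  admissible from \<open>u\<close>: in the first phase \<open>u\<close> has lost the good, in the
  second it is the owner itself.\<close>

lemma scan_move:
  assumes "scan \<sigma> B u j k ow h d" "u < n" "k < n" "j < m" "P < d u" "admissible \<sigma> ow h u j k"
  shows "scan \<sigma> B u j (Suc k) (ow(j := if \<sigma> then k else u)) h (d(u := d u - p j, k := d k + p j))"
proof -
  let ?ow = "ow(j := if \<sigma> then k else u)" and ?d = "d(u := d u - p j, k := d k + p j)"
  have labelling: "labelling \<sigma> ow h d" using assms(1) by (simp add: scan_def)
  have new: "labelling \<sigma> ?ow h ?d" "pot \<sigma> ?ow h < pot \<sigma> ow h"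
    using labelling_move[OF labelling assms(2-6)] by auto
  have "pot \<sigma> ?ow h < B" using new(2) assms(1) by (simp add: scan_def)
  moreover have "\<not> admissible \<sigma> ?ow h u j' k'"
    if "j' < m" "k' < n" "j' < j \<or> j' = j \<and> k' < Suc k" for j' k'
  proof (cases "j' = j")
    case True
    have "h u = Suc (h k)" using assms(6) by (simp add: admissible_def)
    then show ?thesis using True by (cases "k = u") (auto simp: admissible_def edge_def split: if_splits)
  next
    case False
    then show ?thesis using that assms(1,5) by (auto simp: scan_def admissible_def edge_def)
  qed
  ultimately show ?thesis using new(1) by (simp add: scan_def)
qed

text \<open>Processing an active agent always lowers the potential. If the scan ends with
  \<open>u\<close> inactive, some push did it, as \<open>scan\<close> records by
  \<open>pot < B\<close>; if \<open>u\<close> is still active, no push remains and this relabelling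
  does it.\<close>

lemma scan_end:
  assumes "scan \<sigma> B u m 0 ow h d" "u < n" "P < d u"
  shows "labelling \<sigma> ow (h(u := Suc (h u))) d" "pot \<sigma> ow (h(u := Suc (h u))) < B"
proof -
  have labelling: "labelling \<sigma> ow h d" using assms(1) by (simp add: scan_def)
  have "\<not> admissible \<sigma> ow h u j w" if "j < m" "w < n" for j w
    using assms(1,3) that by (simp add: scan_def)
  from labelling_relabel[OF labelling assms(2,3) this]
  show "labelling \<sigma> ow (h(u := Suc (h u))) d" "pot \<sigma> ow (h(u := Suc (h u))) < B"
    using assms(1) by (auto simp: scan_def)
qed

section \<open>Beginning, change and end of the phases\<close>

lemma labelling_initial:
  assumes "owned ow" "\<And>i. i < n \<Longrightarrow> d i = spend ow i - e i" "\<And>i. i < n \<Longrightarrow> h i = 0"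
  shows "labelling True ow h d"
  using assms by (simp add: labelling_def dev_def)

text \<open>The exit condition of the first phase, negated, is precisely the lower bound that the
  second phase has to maintain.\<close>

lemma labelling_switch:
  assumes "labelling True ow h d" "\<And>i. i < n \<Longrightarrow> d i \<le> P" "\<And>i. i < n \<Longrightarrow> d' i = - d i"
    "\<And>i. i < n \<Longrightarrow> h' i = 0"
  shows "labelling False ow h' d'"
proof -
  have d: "d i = spend ow i - e i" if "i < n" for i
    using assms(1) that by (simp add: labelling_def dev_def)
  have "- P \<le> d' i" "d' i = e i - spend ow i" if "i < n" for i
    using assms(2,3)[OF that] d[OF that] by linarith+
  then show ?thesis using assms(1,4) by (simp add: labelling_def dev_def)
qed

lemma labelling_final:
  assumes "labelling False ow h d" "\<And>i. i < n \<Longrightarrow> d i \<le> P" "i < n"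
  shows "\<bar>spend ow i - e i\<bar> \<le> P"
proof -
  have "d i = e i - spend ow i" "- P \<le> d i"
    using assms(1,3) unfolding labelling_def dev_def by auto
  then show ?thesis using assms(2)[OF assms(3)] by linarith
qed

end

section \<open>The rounding program\<close>

abbreviation cell :: "string \<Rightarrow> iexp" where
  "cell v \<equiv> IGet v (IConst 0)"

text \<open>Row offsets are tabulated by repeated addition because additive programs cannot
  multiply. The loop also fills entry \<open>n\<close>: \<open>output_code\<close> sends goods of
  the dummy owner to a row past the end of the matrix.\<close>

definition rows_code :: com where
  "rows_code = For ''i'' ''n''
     (ISet ''R'' (IAdd (cell ''i'') (IConst 1)) (IAdd (IGet ''R'' (cell ''i'')) (cell ''m'')))"

definition max_code :: com where
  "max_code = For ''j'' ''m''
     (Cond (RLess (RGet ''P'' (IConst 0)) (RGet ''p'' (cell ''j'')))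
       (RSet ''P'' (IConst 0) (RGet ''p'' (cell ''j''))) Skip)"

definition owner_step :: com where
  "owner_step =
     Cond (RLess (RConst 0) (RGet ''x'' (IAdd (IGet ''R'' (cell ''k'')) (cell ''j''))))
       (ISet ''o'' (cell ''j'') (cell ''k'')) Skip"

definition owner_code :: com where
  "owner_code = For ''j'' ''m''
     (Seq (ISet ''o'' (cell ''j'') (cell ''n'')) (For ''k'' ''n'' owner_step))"

definition spend_code :: com where
  "spend_code = For ''j'' ''m''
     (RSet ''d'' (IGet ''o'' (cell ''j''))
       (RAdd (RGet ''d'' (IGet ''o'' (cell ''j''))) (RGet ''p'' (cell ''j''))))"

definition dev_code :: com where
  "dev_code = For ''i'' ''n''
     (RSet ''d'' (cell ''i'') (RSub (RGet ''d'' (cell ''i'')) (RGet ''e'' (cell ''i''))))"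

definition active :: bexp where
  "active = RLess (RGet ''P'' (IConst 0)) (RGet ''d'' (cell ''i''))"

definition ieq :: "iexp \<Rightarrow> iexp \<Rightarrow> bexp" where
  "ieq a b = BAnd (BNot (ILess a b)) (BNot (ILess b a))"

definition edge_test :: "bool \<Rightarrow> bexp" where
  "edge_test \<sigma> =
     BAnd (ieq (IGet ''o'' (cell ''j'')) (cell (if \<sigma> then ''i'' else ''k'')))
       (RLess (RConst 0)
         (RGet ''x'' (IAdd (IGet ''R'' (cell (if \<sigma> then ''k'' else ''i''))) (cell ''j''))))"

text \<open>Activity is tested before every single push, because each push from the agent lowers its
  deviation, possibly below the threshold.\<close>

definition move_step :: "bool \<Rightarrow> com" where
  "move_step \<sigma> =
     Cond (BAnd active (BAnd (edge_test \<sigma>)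
         (ieq (IGet ''h'' (cell ''i'')) (IAdd (IGet ''h'' (cell ''k'')) (IConst 1)))))
       (Seq (ISet ''o'' (cell ''j'') (cell (if \<sigma> then ''k'' else ''i'')))
         (Seq (RSet ''d'' (cell ''i'') (RSub (RGet ''d'' (cell ''i'')) (RGet ''p'' (cell ''j''))))
           (RSet ''d'' (cell ''k'') (RAdd (RGet ''d'' (cell ''k'')) (RGet ''p'' (cell ''j''))))))
       Skip"

definition relabel_step :: com where
  "relabel_step =
     Cond active (ISet ''h'' (cell ''i'') (IAdd (IGet ''h'' (cell ''i'')) (IConst 1))) Skip"

definition scan_code :: "bool \<Rightarrow> com" where
  "scan_code \<sigma> = For ''j'' ''m'' (For ''k'' ''n'' (move_step \<sigma>))"

definition process_code :: "bool \<Rightarrow> com" where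
  "process_code \<sigma> = Cond active
     (Seq (ISet ''done'' (IConst 0) (IConst 0)) (Seq (scan_code \<sigma>) relabel_step)) Skip"

text \<open>Only a round that meets no active agent leaves ''done'' at 1.\<close>

definition round_code :: "bool \<Rightarrow> com" where
  "round_code \<sigma> = Seq (ISet ''done'' (IConst 0) (IConst 1)) (For ''i'' ''n'' (process_code \<sigma>))"

definition phase_code :: "bool \<Rightarrow> com" where
  "phase_code \<sigma> = Seq (ISet ''done'' (IConst 0) (IConst 0))
     (While (ILess (cell ''done'') (IConst 1)) (round_code \<sigma>))"

definition negate_code :: com where
  "negate_code = For ''i'' ''n''
     (Seq (RSet ''d'' (cell ''i'') (RSub (RConst 0) (RGet ''d'' (cell ''i''))))
       (ISet ''h'' (cell ''i'') (IConst 0)))"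

definition output_code :: com where
  "output_code = For ''j'' ''m''
     (Seq (RSet ''x_out'' (IAdd (IGet ''R'' (IGet ''o'' (cell ''j''))) (cell ''j'')) (RConst 1))
       (RSet ''e_out'' (IGet ''o'' (cell ''j''))
         (RAdd (RGet ''e_out'' (IGet ''o'' (cell ''j''))) (RGet ''p'' (cell ''j'')))))"

definition rounding_code :: com where
  "rounding_code = Seq rows_code (Seq max_code (Seq owner_code (Seq spend_code (Seq dev_code
     (Seq (phase_code True) (Seq negate_code (Seq (phase_code False) output_code)))))))"

lemma bval_ieq [simp]: "bval (ieq a b) s \<longleftrightarrow> ival a s = ival b s"
  by (auto simp: ieq_def)

definition scan_time :: "bool \<Rightarrow> nat \<Rightarrow> nat" where
  "scan_time \<sigma> N = for_time N (for_time N (ccost (move_step \<sigma>)))"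

definition process_time :: "bool \<Rightarrow> nat \<Rightarrow> nat" where
  "process_time \<sigma> N =
     1 + bcost active + (3 + (scan_time \<sigma> N + ccost relabel_step))"

text \<open>The number of rounds is the bound of \<open>pot_le\<close> with both dimensions enlarged
  to \<open>N\<close>, plus the 2 from \<open>runs_While\<close>.\<close>

definition phase_time :: "bool \<Rightarrow> nat \<Rightarrow> nat" where
  "phase_time \<sigma> N = 3 + (Suc N * (N * N) + N * N + 2) *
     (1 + bcost (ILess (cell ''done'') (IConst 1)) + (3 + for_time N (process_time \<sigma> N)))"

section \<open>Memory layout, and correctness of the two phases\<close>

context rounding
begin

definition inputs :: "state \<Rightarrow> bool" where
  "inputs s \<longleftrightarrow> imem s ''n'' 0 = n \<and> imem s ''m'' 0 = m \<and>
     (\<forall>i<n. \<forall>j<m. rmem s ''x'' (i * m + j) = x i j) \<and>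
     (\<forall>j<m. rmem s ''p'' j = p j) \<and> (\<forall>i<n. rmem s ''e'' i = e i)"

text \<open>\<open>output_code\<close> writes only the entries 1 of the matrix and adds up the
  budgets in place, so both arrays must be zero when it starts.\<close>

definition fresh :: "state \<Rightarrow> bool" where
  "fresh s \<longleftrightarrow> rmem s ''x_out'' = (\<lambda>_. 0) \<and> rmem s ''e_out'' = (\<lambda>_. 0)"

definition rows :: "nat \<Rightarrow> state \<Rightarrow> bool" where
  "rows k s \<longleftrightarrow> (\<forall>i\<le>k. imem s ''R'' i = i * m)"

definition base :: "state \<Rightarrow> bool" where
  "base s \<longleftrightarrow> inputs s \<and> rows n s \<and> rmem s ''P'' 0 = P"

lemma inputs_upd [simp]:
  "a \<notin> {''n'', ''m''} \<Longrightarrow> inputs (iupd a k c s) \<longleftrightarrow> inputs s"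
  "a \<notin> {''x'', ''p'', ''e''} \<Longrightarrow> inputs (rupd a k r s) \<longleftrightarrow> inputs s"
  by (auto simp: inputs_def)

lemma fresh_upd [simp]:
  "fresh (iupd a k c s) \<longleftrightarrow> fresh s"
  "a \<notin> {''x_out'', ''e_out''} \<Longrightarrow> fresh (rupd a k r s) \<longleftrightarrow> fresh s"
  by (auto simp: fresh_def)

lemma rows_upd [simp]:
  "a \<noteq> ''R'' \<Longrightarrow> rows l (iupd a k c s) \<longleftrightarrow> rows l s"
  "rows l (rupd a k r s) \<longleftrightarrow> rows l s"
  by (auto simp: rows_def)

lemma base_upd [simp]:
  "a \<notin> {''n'', ''m'', ''R''} \<Longrightarrow> base (iupd a k c s) \<longleftrightarrow> base s"
  "a \<notin> {''x'', ''p'', ''e'', ''P''} \<Longrightarrow> base (rupd a k r s) \<longleftrightarrow> base s"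
  by (auto simp: base_def)

lemma inputs_read:
  assumes "inputs s"
  shows "imem s ''n'' 0 = n" "imem s ''m'' 0 = m" "i < n \<Longrightarrow> j < m \<Longrightarrow> rmem s ''x'' (i * m + j) = x i j"
    "j < m \<Longrightarrow> rmem s ''p'' j = p j" "i < n \<Longrightarrow> rmem s ''e'' i = e i"
  using assms by (auto simp: inputs_def)

lemma base_read:
  assumes "base s"
  shows "imem s ''n'' 0 = n" "imem s ''m'' 0 = m" "i < n \<Longrightarrow> j < m \<Longrightarrow> rmem s ''x'' (i * m + j) = x i j"
    "j < m \<Longrightarrow> rmem s ''p'' j = p j" "i < n \<Longrightarrow> rmem s ''e'' i = e i" "i \<le> n \<Longrightarrow> imem s ''R'' i = i * m"
    "rmem s ''P'' 0 = P"
  using assms by (auto simp: base_def rows_def inputs_def)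

abbreviation "N \<equiv> n + m"

definition conf :: "bool \<Rightarrow> state \<Rightarrow> bool" where
  "conf \<sigma> s \<longleftrightarrow> base s \<and> fresh s \<and> labelling \<sigma> (imem s ''o'') (imem s ''h'') (rmem s ''d'')"

definition spot :: "bool \<Rightarrow> state \<Rightarrow> nat" where
  "spot \<sigma> s = pot \<sigma> (imem s ''o'') (imem s ''h'')"

definition sscan :: "bool \<Rightarrow> nat \<Rightarrow> nat \<Rightarrow> nat \<Rightarrow> nat \<Rightarrow> state \<Rightarrow> bool" where
  "sscan \<sigma> B u j k s \<longleftrightarrow> base s \<and> fresh s \<and> imem s ''i'' 0 = u \<and> imem s ''done'' 0 = 0 \<and>
     scan \<sigma> B u j k (imem s ''o'') (imem s ''h'') (rmem s ''d'')"

lemma move_step_correct: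
  assumes s: "sscan \<sigma> B u j k s" "imem s ''j'' 0 = j" "imem s ''k'' 0 = k"
    and lt: "u < n" "j < m" "k < n"
  shows "sscan \<sigma> B u j (Suc k) (step (move_step \<sigma>) s)"
proof -
  have b: "base s" and u: "imem s ''i'' 0 = u"
    and sc: "scan \<sigma> B u j k (imem s ''o'') (imem s ''h'') (rmem s ''d'')"
    using s(1) by (auto simp: sscan_def)
  let ?c = "P < rmem s ''d'' u \<and> admissible \<sigma> (imem s ''o'') (imem s ''h'') u j k"
  have guard: "bval (BAnd active (BAnd (edge_test \<sigma>)
      (ieq (IGet ''h'' (cell ''i'')) (IAdd (IGet ''h'' (cell ''k'')) (IConst 1))))) s \<longleftrightarrow> ?c"
    using base_read[OF b] lt u s(2,3)
    by (auto simp: active_def edge_test_def admissible_def edge_def)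
  show ?thesis
  proof (cases ?c)
    case False
    have "step (move_step \<sigma>) s = s" unfolding move_step_def step.simps guard using False by (simp only: if_False)
    then show ?thesis using s(1) scan_skip[OF sc False] by (simp add: sscan_def)
  next
    case True
    \<comment> \<open>The program reads the deviation of \<open>k\<close> after having changed that
      of \<open>u\<close>; as the two agents differ, it still finds the old value.\<close>
    then have "k \<noteq> u" by (auto simp: admissible_def)
    then show ?thesis
      unfolding move_step_def step.simps guard
      using True s(1) scan_move[OF sc lt(1,3,2)] u s(2,3) base_read(4)[OF b lt(2)]
      by (cases \<sigma>) (simp_all add: sscan_def)
  qed
qed

lemma scan_correct:
  assumes "sscan \<sigma> B u 0 0 s" "u < n"
  shows "runs (scan_code \<sigma>) s (scan_time \<sigma> N) (sscan \<sigma> B u m 0)"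
  unfolding scan_code_def scan_time_def
proof (rule runs_For[where I = "\<lambda>j. sscan \<sigma> B u j 0"])
  fix j s assume j: "j < m" "sscan \<sigma> B u j 0 s" "imem s ''j'' 0 = j"
  show "runs (For ''k'' ''n'' (move_step \<sigma>)) s (for_time N (ccost (move_step \<sigma>)))
      (\<lambda>s'. sscan \<sigma> B u (Suc j) 0 s' \<and> imem s' ''j'' 0 = j)"
  proof (rule runs_mono[OF runs_For[where I = "\<lambda>k s. sscan \<sigma> B u j k s \<and> imem s ''j'' 0 = j"
        and N = n and N' = N]])
    fix k s assume k: "k < n" "sscan \<sigma> B u j k s \<and> imem s ''j'' 0 = j" "imem s ''k'' 0 = k"
    show "runs (move_step \<sigma>) s (ccost (move_step \<sigma>))
        (\<lambda>s'. (sscan \<sigma> B u j (Suc k) s' \<and> imem s' ''j'' 0 = j) \<and> imem s' ''k'' 0 = k)"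
    proof (rule runs_straight)
      show "straight (move_step \<sigma>)" by (simp add: move_step_def)
      show "(sscan \<sigma> B u j (Suc k) (step (move_step \<sigma>) s) \<and> imem (step (move_step \<sigma>) s) ''j'' 0 = j) \<and>
          imem (step (move_step \<sigma>) s) ''k'' 0 = k"
        using move_step_correct[of \<sigma> B u j k s] k j(1) assms(2)
        by (auto simp: move_step_def simp del: bval.simps)
    qed
  qed (use j in \<open>auto simp: sscan_def base_read(1) intro: scan_row\<close>)
qed (use assms in \<open>auto simp: sscan_def base_read(2)\<close>)

text \<open>Flag 0 certifies progress below the potential \<open>B\<close>, flag 1 that no agent
  visited so far is active. With flag 0 nothing is claimed about visited agents, since pushes may
  have made them active.\<close>

definition processed :: "bool \<Rightarrow> nat \<Rightarrow> nat \<Rightarrow> state \<Rightarrow> bool" where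
  "processed \<sigma> B k s \<longleftrightarrow> conf \<sigma> s \<and> spot \<sigma> s \<le> B \<and>
     (imem s ''done'' 0 = 0 \<and> spot \<sigma> s < B \<or>
      imem s ''done'' 0 = 1 \<and> (\<forall>i<k. rmem s ''d'' i \<le> P))"

lemma process_correct:
  assumes s: "processed \<sigma> B u s" "imem s ''i'' 0 = u" "u < n"
  shows "runs (process_code \<sigma>) s (process_time \<sigma> N) (\<lambda>s'. processed \<sigma> B (Suc u) s' \<and> imem s' ''i'' 0 = u)"
  unfolding process_code_def process_time_def
proof (rule runs_Cond)
  have b: "base s" using s(1) by (simp add: processed_def conf_def)
  have act: "bval active s \<longleftrightarrow> P < rmem s ''d'' u"
    using base_read(7)[OF b] s(2) by (simp add: active_def)
  {
    assume "\<not> bval active s"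
    then have "processed \<sigma> B (Suc u) s"
      using s(1) act by (auto simp: processed_def less_Suc_eq)
    then show "runs Skip s (3 + (scan_time \<sigma> N + ccost relabel_step))
        (\<lambda>s'. processed \<sigma> B (Suc u) s' \<and> imem s' ''i'' 0 = u)"
      using s(2) by (intro runs_step) auto
  }
  assume "bval active s"
  then have a: "P < rmem s ''d'' u" using act by simp
  show "runs (Seq (ISet ''done'' (IConst 0) (IConst 0)) (Seq (scan_code \<sigma>) relabel_step)) s
      (3 + (scan_time \<sigma> N + ccost relabel_step))
      (\<lambda>s'. processed \<sigma> B (Suc u) s' \<and> imem s' ''i'' 0 = u)"
  proof (rule runs_Seq)
    have "sscan \<sigma> B u 0 0 (iupd ''done'' 0 0 s)"
      using s a scan_start by (simp add: processed_def conf_def sscan_def spot_def)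
    then show "runs (ISet ''done'' (IConst 0) (IConst 0)) s 3 (sscan \<sigma> B u 0 0)"
      by (intro runs_step) auto
    fix s assume "sscan \<sigma> B u 0 0 s"
    then show "runs (Seq (scan_code \<sigma>) relabel_step) s (scan_time \<sigma> N + ccost relabel_step)
        (\<lambda>s'. processed \<sigma> B (Suc u) s' \<and> imem s' ''i'' 0 = u)"
    proof (rule runs_Seq[OF scan_correct[OF _ s(3)]])
      fix s assume sc: "sscan \<sigma> B u m 0 s"
      then have sc': "scan \<sigma> B u m 0 (imem s ''o'') (imem s ''h'') (rmem s ''d'')"
        and bs: "base s" "fresh s" "imem s ''i'' 0 = u" "imem s ''done'' 0 = 0"
        by (auto simp: sscan_def)
      have "processed \<sigma> B (Suc u) (step relabel_step s) \<and> imem (step relabel_step s) ''i'' 0 = u"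
      proof (cases "P < rmem s ''d'' u")
        case True
        then show ?thesis
          using scan_end[OF sc' s(3) True] bs base_read(7)[OF bs(1)]
          by (simp add: relabel_step_def active_def processed_def conf_def spot_def)
      next
        case False
        then show ?thesis
          using sc' bs base_read(7)[OF bs(1)]
          by (simp add: relabel_step_def active_def processed_def conf_def spot_def scan_def)
      qed
      then show "runs relabel_step s (ccost relabel_step)
          (\<lambda>s'. processed \<sigma> B (Suc u) s' \<and> imem s' ''i'' 0 = u)"
        by (intro runs_straight) (simp add: relabel_step_def)
    qed
  qed
qed

lemma round_correct:
  assumes "conf \<sigma> s" "spot \<sigma> s \<le> B"
  shows "runs (round_code \<sigma>) s (3 + for_time N (process_time \<sigma> N)) (processed \<sigma> B n)"
  unfolding round_code_def
proof (rule runs_Seq)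
  show "runs (ISet ''done'' (IConst 0) (IConst 1)) s 3 (processed \<sigma> B 0)"
    using assms
    by (intro runs_step) (auto simp: processed_def conf_def spot_def)
  fix s assume "processed \<sigma> B 0 s"
  then show "runs (For ''i'' ''n'' (process_code \<sigma>)) s (for_time N (process_time \<sigma> N)) (processed \<sigma> B n)"
    by (intro runs_For[where I = "processed \<sigma> B"] process_correct) (auto simp: processed_def conf_def spot_def base_read(1))
qed

lemma phase_correct:
  assumes "conf \<sigma> s"
  shows "runs (phase_code \<sigma>) s (phase_time \<sigma> N) (\<lambda>s. conf \<sigma> s \<and> (\<forall>i<n. rmem s ''d'' i \<le> P))"
  unfolding phase_code_def phase_time_def
proof (rule runs_Seq)
  let ?b = "ILess (cell ''done'') (IConst 1)"
  let ?I = "\<lambda>s. conf \<sigma> s \<and> (imem s ''done'' 0 \<noteq> 0 \<longrightarrow> (\<forall>i<n. rmem s ''d'' i \<le> P))"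
  show "runs (ISet ''done'' (IConst 0) (IConst 0)) s 3 ?I"
    using assms by (intro runs_step) (auto simp: conf_def)
  fix s assume I: "?I s"
  have "spot \<sigma> s \<le> Suc m * (n * n) + m * n"
    using I pot_le unfolding conf_def spot_def by blast
  also have "\<dots> \<le> Suc N * (N * N) + N * N" by (intro add_mono mult_le_mono) auto
  finally have F: "spot \<sigma> s \<le> Suc N * (N * N) + N * N" .
  have "runs (While ?b (round_code \<sigma>)) s
     ((Suc N * (N * N) + N * N + 2) * (1 + bcost ?b + (3 + for_time N (process_time \<sigma> N))))
     (\<lambda>s. ?I s \<and> \<not> bval ?b s)"
  \<comment> \<open>The bound \<open>B\<close> of a round is the potential at its start, so a
    further round takes place only if this one has lowered it.\<close>
  proof (rule runs_While[where f = "spot \<sigma>"])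
    fix s assume "?I s" "bval ?b s"
    then have "conf \<sigma> s" by simp
    then show "runs (round_code \<sigma>) s (3 + for_time N (process_time \<sigma> N))
        (\<lambda>s'. ?I s' \<and> (bval ?b s' \<longrightarrow> spot \<sigma> s' < spot \<sigma> s))"
      by (intro runs_mono[OF round_correct]) (auto simp: processed_def)
  qed (use I F in auto)
  then show "runs (While ?b (round_code \<sigma>)) s
     ((Suc N * (N * N) + N * N + 2) * (1 + bcost ?b + (3 + for_time N (process_time \<sigma> N))))
     (\<lambda>s. conf \<sigma> s \<and> (\<forall>i<n. rmem s ''d'' i \<le> P))"
    by (rule runs_mono) auto
qed

section \<open>Initialisation, change of phase and output\<close>

definition blank :: "state \<Rightarrow> bool" where
  "blank s \<longleftrightarrow> imem s ''h'' = (\<lambda>_. 0) \<and> rmem s ''d'' = (\<lambda>_. 0)"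

lemma blank_upd [simp]:
  "a \<noteq> ''h'' \<Longrightarrow> blank (iupd a k c s) \<longleftrightarrow> blank s"
  "a \<noteq> ''d'' \<Longrightarrow> blank (rupd a k r s) \<longleftrightarrow> blank s"
  by (auto simp: blank_def)

lemma rows_correct:
  assumes "inputs s" "fresh s" "blank s" "rows 0 s" "rmem s ''P'' 0 = 0"
  shows "runs rows_code s (for_time N 12)
    (\<lambda>s. inputs s \<and> fresh s \<and> blank s \<and> rows n s \<and> rmem s ''P'' 0 = 0)"
  unfolding rows_code_def
proof (rule runs_For[where I = "\<lambda>k s. inputs s \<and> fresh s \<and> blank s \<and> rows k s \<and> rmem s ''P'' 0 = 0"])
  let ?c = "ISet ''R'' (IAdd (cell ''i'') (IConst 1)) (IAdd (IGet ''R'' (cell ''i'')) (cell ''m''))"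
  fix k s
  assume k: "k < n" "inputs s \<and> fresh s \<and> blank s \<and> rows k s \<and> rmem s ''P'' 0 = 0" "imem s ''i'' 0 = k"
  then have "rows (Suc k) (iupd ''R'' (Suc k) (imem s ''R'' k + m) s)"
    by (auto simp: rows_def le_Suc_eq)
  then show "runs ?c s 12
     (\<lambda>s'. (inputs s' \<and> fresh s' \<and> blank s' \<and> rows (Suc k) s' \<and> rmem s' ''P'' 0 = 0) \<and> imem s' ''i'' 0 = k)"
    using k inputs_read(2)[of s]
    by (intro runs_step) simp_all
qed (use assms in \<open>auto simp: inputs_read(1)\<close>)

lemma sup_norm_Suc: "sup_norm (Suc k) u = max (sup_norm k u) \<bar>u k\<bar>"
proof -
  have "insert 0 ((\<lambda>i. \<bar>u i\<bar>) ` {..<Suc k}) = insert \<bar>u k\<bar> (insert 0 ((\<lambda>i. \<bar>u i\<bar>) ` {..<k}))"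
    by (auto simp: less_Suc_eq)
  then show ?thesis unfolding sup_norm_def by (simp add: max.commute)
qed

lemma max_correct:
  assumes "inputs s" "fresh s" "blank s" "rows n s" "rmem s ''P'' 0 = 0" "P = sup_norm m p"
  shows "runs max_code s (for_time N 20) (\<lambda>s. base s \<and> fresh s \<and> blank s)"
proof -
  have "runs max_code s (for_time N 20)
    (\<lambda>s. inputs s \<and> fresh s \<and> blank s \<and> rows n s \<and> rmem s ''P'' 0 = sup_norm m p)"
    unfolding max_code_def
  proof (rule runs_For[where I = "\<lambda>k s. inputs s \<and> fresh s \<and> blank s \<and> rows n s \<and> rmem s ''P'' 0 = sup_norm k p"])
    let ?c = "Cond (RLess (RGet ''P'' (IConst 0)) (RGet ''p'' (cell ''j'')))
       (RSet ''P'' (IConst 0) (RGet ''p'' (cell ''j''))) Skip"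
    fix k s
    assume k: "k < m" "inputs s \<and> fresh s \<and> blank s \<and> rows n s \<and> rmem s ''P'' 0 = sup_norm k p"
      "imem s ''j'' 0 = k"
    show "runs ?c s 20 (\<lambda>s'. (inputs s' \<and> fresh s' \<and> blank s' \<and> rows n s' \<and>
        rmem s' ''P'' 0 = sup_norm (Suc k) p) \<and> imem s' ''j'' 0 = k)"
      using k inputs_read(4)[of s k] p_nonneg[OF k(1)]
      by (intro runs_step) (auto simp: sup_norm_Suc max_def)
  qed (use assms in \<open>auto simp: inputs_read(2) sup_norm_def\<close>)
  then show ?thesis by (rule runs_mono) (simp_all add: base_def assms(6)[symmetric])
qed

definition owned_upto :: "nat \<Rightarrow> (nat \<Rightarrow> nat) \<Rightarrow> bool" where
  "owned_upto k ow \<longleftrightarrow> (\<forall>j<k. ow j < n \<and> 0 < x (ow j) j \<or> ow j = n \<and> p j = 0)"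

lemma owner_correct:
  assumes "base s" "fresh s" "blank s"
  shows "runs owner_code s (for_time N (6 + for_time N 20))
    (\<lambda>s. base s \<and> fresh s \<and> blank s \<and> owned (imem s ''o''))"
proof -
  let ?I = "\<lambda>k s. base s \<and> fresh s \<and> blank s \<and> owned_upto k (imem s ''o'')"
  have "runs owner_code s (for_time N (6 + for_time N 20)) (?I m)"
    unfolding owner_code_def
  proof (rule runs_For[where I = ?I])
    fix j s assume j: "j < m" "?I j s" "imem s ''j'' 0 = j"
    let ?J = "\<lambda>k s. base s \<and> fresh s \<and> blank s \<and> owned_upto j (imem s ''o'') \<and> imem s ''j'' 0 = j \<and>
      (imem s ''o'' j < n \<and> 0 < x (imem s ''o'' j) j \<or> imem s ''o'' j = n \<and> (\<forall>i<k. x i j = 0))"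
    show "runs (Seq (ISet ''o'' (cell ''j'') (cell ''n'')) (For ''k'' ''n'' owner_step)) s
       (6 + for_time N 20) (\<lambda>s'. ?I (Suc j) s' \<and> imem s' ''j'' 0 = j)"
    proof (rule runs_Seq)
      show "runs (ISet ''o'' (cell ''j'') (cell ''n'')) s 6 (?J 0)"
        using j by (intro runs_step) (auto simp: base_read(1) owned_upto_def)
      fix s assume J: "?J 0 s"
      have "runs (For ''k'' ''n'' owner_step) s (for_time N 20) (?J n)"
      proof (rule runs_For[where I = ?J])
        fix k s assume k: "k < n" "?J k s" "imem s ''k'' 0 = k"
        have b: "base s" using k by simp
        have "?J (Suc k) (step owner_step s) \<and> imem (step owner_step s) ''k'' 0 = k"
          using k(2,3) base_read(3,6)[OF b, of k] k(1) j(1) x_nonneg[OF k(1) j(1)]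
          by (auto simp: owner_step_def owned_upto_def less_Suc_eq)
        show "runs owner_step s 20 (\<lambda>s'. ?J (Suc k) s' \<and> imem s' ''k'' 0 = k)"
          by (rule runs_step) (fact, simp_all add: owner_step_def)
      qed (use J in \<open>auto simp: base_read(1)\<close>)
      then show "runs (For ''k'' ''n'' owner_step) s (for_time N 20) (\<lambda>s'. ?I (Suc j) s' \<and> imem s' ''j'' 0 = j)"
      proof (rule runs_mono)
        fix s assume J: "?J n s"
        \<comment> \<open>A column of zeros cannot sum to 1, so clearing forces the price to be
          0.\<close>
        have "p j = 0" if "\<forall>i<n. x i j = 0" using cleared[OF j(1)] that by simp
        then show "?I (Suc j) s \<and> imem s ''j'' 0 = j"
          using J by (auto simp: owned_upto_def less_Suc_eq)
      qed simp
    qed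
  qed (use assms in \<open>auto simp: owned_upto_def base_read(2)\<close>)
  then show ?thesis by (rule runs_mono) (auto simp: owned_upto_def owned_def)
qed

lemma spend_correct:
  assumes "base s" "fresh s" "blank s" "owned (imem s ''o'')"
  shows "runs spend_code s (for_time N 20)
    (\<lambda>s. base s \<and> fresh s \<and> imem s ''h'' = (\<lambda>_. 0) \<and> owned (imem s ''o'') \<and>
      rmem s ''d'' = spend (imem s ''o''))"
proof -
  let ?I = "\<lambda>k s. base s \<and> fresh s \<and> imem s ''h'' = (\<lambda>_. 0) \<and> owned (imem s ''o'') \<and>
    rmem s ''d'' = (\<lambda>i. \<Sum>j<k. if imem s ''o'' j = i then p j else 0)"
  have "runs spend_code s (for_time N 20) (?I m)"
    unfolding spend_code_def
  proof (rule runs_For[where I = ?I])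
    let ?c = "RSet ''d'' (IGet ''o'' (cell ''j''))
       (RAdd (RGet ''d'' (IGet ''o'' (cell ''j''))) (RGet ''p'' (cell ''j'')))"
    fix k s assume k: "k < m" "?I k s" "imem s ''j'' 0 = k"
    have "?I (Suc k) (step ?c s) \<and> imem (step ?c s) ''j'' 0 = k"
      using k base_read(4)[of s k] by (auto simp: fun_eq_iff)
    show "runs ?c s 20 (\<lambda>s'. ?I (Suc k) s' \<and> imem s' ''j'' 0 = k)"
      by (rule runs_step) (fact, simp_all)
  qed (use assms in \<open>auto simp: base_read(2) blank_def\<close>)
  then show ?thesis by (rule runs_mono) (auto simp: spend_def fun_eq_iff)
qed

lemma dev_correct:
  assumes "base s" "fresh s" "imem s ''h'' = (\<lambda>_. 0)" "owned (imem s ''o'')"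
    "rmem s ''d'' = spend (imem s ''o'')"
  shows "runs dev_code s (for_time N 20) (conf True)"
proof -
  let ?I = "\<lambda>k s. base s \<and> fresh s \<and> imem s ''h'' = (\<lambda>_. 0) \<and> owned (imem s ''o'') \<and>
    (\<forall>i<n. rmem s ''d'' i = spend (imem s ''o'') i - (if i < k then e i else 0))"
  have "runs dev_code s (for_time N 20) (?I n)"
    unfolding dev_code_def
  proof (rule runs_For[where I = ?I])
    let ?c = "RSet ''d'' (cell ''i'') (RSub (RGet ''d'' (cell ''i'')) (RGet ''e'' (cell ''i'')))"
    fix k s assume k: "k < n" "?I k s" "imem s ''i'' 0 = k"
    have "?I (Suc k) (step ?c s) \<and> imem (step ?c s) ''i'' 0 = k"
      using k base_read(5)[of s k] by (auto simp: less_Suc_eq)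
    show "runs ?c s 20 (\<lambda>s'. ?I (Suc k) s' \<and> imem s' ''i'' 0 = k)"
      by (rule runs_step) (fact, simp_all)
  qed (use assms in \<open>auto simp: base_read(1)\<close>)
  then show ?thesis by (rule runs_mono) (auto simp: conf_def intro!: labelling_initial)
qed

lemma negate_correct:
  assumes "conf True s" "\<forall>i<n. rmem s ''d'' i \<le> P"
  shows "runs negate_code s (for_time N 20) (conf False)"
proof -
  let ?I = "\<lambda>k t. base t \<and> fresh t \<and> imem t ''o'' = imem s ''o'' \<and>
    (\<forall>i<n. rmem t ''d'' i = (if i < k then - rmem s ''d'' i else rmem s ''d'' i)) \<and>
    (\<forall>i<k. imem t ''h'' i = 0)"
  have "runs negate_code s (for_time N 20) (?I n)"
    unfolding negate_code_def
  proof (rule runs_For[where I = ?I])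
    let ?c = "Seq (RSet ''d'' (cell ''i'') (RSub (RConst 0) (RGet ''d'' (cell ''i''))))
       (ISet ''h'' (cell ''i'') (IConst 0))"
    fix k t assume k: "k < n" "?I k t" "imem t ''i'' 0 = k"
    have "?I (Suc k) (step ?c t) \<and> imem (step ?c t) ''i'' 0 = k"
      using k by (auto simp: less_Suc_eq)
    show "runs ?c t 20 (\<lambda>s'. ?I (Suc k) s' \<and> imem s' ''i'' 0 = k)"
      by (rule runs_step) (fact, simp_all)
  qed (use assms in \<open>auto simp: base_read(1) conf_def\<close>)
  then show ?thesis
  proof (rule runs_mono)
    fix t assume I: "?I n t"
    have "labelling False (imem s ''o'') (imem t ''h'') (rmem t ''d'')"
      using assms I unfolding conf_def by (intro labelling_switch[of _ "imem s ''h''" "rmem s ''d''"]) auto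
    then show "conf False t" using I by (simp add: conf_def)
  qed simp
qed

definition result :: "state \<Rightarrow> bool" where
  "result s \<longleftrightarrow> (\<exists>ow. owned ow \<and> (\<forall>i<n. \<bar>spend ow i - e i\<bar> \<le> P) \<and>
     rmem s ''e_out'' = spend ow \<and>
     (\<forall>i<n. \<forall>j<m. rmem s ''x_out'' (i * m + j) = (if ow j = i then 1 else 0)))"

text \<open>The rows are unbounded, so this also separates the matrix from the extra row of the
  dummy owner.\<close>

lemma row_index_eq:
  assumes "j < m" "l < m"
  shows "i * m + j = k * m + l \<longleftrightarrow> i = k \<and> j = l"
proof
  assume eq: "i * m + j = k * m + l"
  have "(i * m + j) div m = i" "(k * m + l) div m = k" using assms by simp_all
  then show "i = k \<and> j = l" using eq by simp
qed simp

lemma output_correct: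
  assumes "conf False s" "\<forall>i<n. rmem s ''d'' i \<le> P"
  shows "runs output_code s (for_time N 40) result"
proof -
  define ow where "ow = imem s ''o''"
  let ?I = "\<lambda>k t. base t \<and> imem t ''o'' = ow \<and>
    rmem t ''e_out'' = (\<lambda>i. \<Sum>j<k. if ow j = i then p j else 0) \<and>
    (\<forall>i<n. \<forall>j<m. rmem t ''x_out'' (i * m + j) = (if j < k \<and> ow j = i then 1 else 0))"
  have i: "labelling False ow (imem s ''h'') (rmem s ''d'')"
    using assms(1) by (simp add: conf_def ow_def)
  have ow: "owned ow" "\<forall>i<n. \<bar>spend ow i - e i\<bar> \<le> P"
    using i labelling_final[OF i] assms(2) by (simp_all add: labelling_def)
  have "runs output_code s (for_time N 40) (?I m)"
    unfolding output_code_def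
  proof (rule runs_For[where I = ?I])
    let ?c = "Seq (RSet ''x_out'' (IAdd (IGet ''R'' (IGet ''o'' (cell ''j''))) (cell ''j'')) (RConst 1))
       (RSet ''e_out'' (IGet ''o'' (cell ''j''))
         (RAdd (RGet ''e_out'' (IGet ''o'' (cell ''j''))) (RGet ''p'' (cell ''j''))))"
    fix k t assume k: "k < m" "?I k t" "imem t ''j'' 0 = k"
    have b: "base t" using k by simp
    have "ow k \<le> n" using ow(1) k(1) by (auto simp: owned_def)
    then have R: "imem t ''R'' (ow k) = ow k * m" by (rule base_read(6)[OF b])
    have "?I (Suc k) (step ?c t) \<and> imem (step ?c t) ''j'' 0 = k"
      using k base_read(4)[OF b k(1)] R row_index_eq[OF _ k(1)]
      by (auto simp: fun_eq_iff less_Suc_eq)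
    show "runs ?c t 40 (\<lambda>s'. ?I (Suc k) s' \<and> imem s' ''j'' 0 = k)"
      by (rule runs_step) (fact, simp_all)
  qed (use assms in \<open>auto simp: base_read(2) conf_def fresh_def ow_def\<close>)
  then show ?thesis
    by (rule runs_mono) (use ow in \<open>auto simp: result_def spend_def fun_eq_iff intro!: exI[of _ ow]\<close>)
qed

end

text \<open>The numerals are generous bounds on the costs of loop bodies; 6 covers the reset of an
  owner in \<open>owner_code\<close>.\<close>

definition rounding_time :: "nat \<Rightarrow> nat" where
  "rounding_time N = for_time N 12 + (for_time N 20 + (for_time N (6 + for_time N 20) +
     (for_time N 20 + (for_time N 20 +
     (phase_time True N + (for_time N 20 + (phase_time False N + for_time N 40)))))))"

lemma (in rounding) rounding_code_correct:
  assumes "inputs s" "fresh s" "blank s" "rows 0 s" "rmem s ''P'' 0 = 0" "P = sup_norm m p"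
  shows "runs rounding_code s (rounding_time N) result"
  unfolding rounding_code_def rounding_time_def
  apply (rule runs_Seq[OF rows_correct[OF assms(1-5)]])
  apply (rule runs_Seq[OF max_correct[OF _ _ _ _ _ assms(6)]], simp_all)
  apply (rule runs_Seq[OF owner_correct], simp_all)
  apply (rule runs_Seq[OF spend_correct], simp_all)
  apply (rule runs_Seq[OF dev_correct], simp_all)
  apply (rule runs_Seq[OF phase_correct], simp_all)
  apply (rule runs_Seq[OF negate_correct], simp_all)
  apply (rule runs_Seq[OF phase_correct], simp_all)
  apply (rule output_correct, simp_all)
  done

lemma polynomial_rounding_time: "polynomial rounding_time"
  unfolding rounding_time_def[abs_def] phase_time_def process_time_def scan_time_def
  by (simp only: Suc_eq_plus1) (intro polynomial_add polynomial_mult polynomial_for_time polynomial_const polynomial_id)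

lemma additive_rounding_code: "additive rounding_code"
  by (simp add: rounding_code_def rows_code_def max_code_def owner_step_def owner_code_def spend_code_def
      dev_code_def active_def ieq_def edge_test_def move_step_def relabel_step_def scan_code_def
      process_code_def round_code_def phase_code_def negate_code_def output_code_def For_def)

section \<open>From machine states back to markets\<close>

lemma finite_cells_input_state:
  "finite (icells (input_state M x p))" "finite (rcells (input_state M x p))"
proof -
  have "icells (input_state M x p) \<subseteq> {''n'', ''m''} \<times> {0}"
    by (auto simp: icells_def input_state_def split: if_splits)
  then show "finite (icells (input_state M x p))" by (rule finite_subset) simp
  have "rcells (input_state M x p) \<subseteq> {''v'', ''e'', ''x'', ''p''} \<times>
      {..<agents M * goods M + agents M + goods M}"
    by (auto simp: rcells_def input_state_def matrix_array_def vector_array_def split: if_splits)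
  then show "finite (rcells (input_state M x p))" by (rule finite_subset) simp
qed

lemma sup_norm_ge: "i < k \<Longrightarrow> \<bar>u i\<bar> \<le> sup_norm k u"
  unfolding sup_norm_def by (intro Max_ge) auto

lemma sup_norm_nonneg: "0 \<le> sup_norm k u"
  unfolding sup_norm_def by (intro Max_ge) auto

lemma sup_norm_le: "0 \<le> c \<Longrightarrow> (\<And>i. i < k \<Longrightarrow> \<bar>u i\<bar> \<le> c) \<Longrightarrow> sup_norm k u \<le> c"
  unfolding sup_norm_def by auto

lemma rounding_equilibrium:
  assumes "equilibrium M x p"
  shows "rounding (agents M) (goods M) x p (budget M) (sup_norm (goods M) p)"
proof
  have out: "market_outcome M x p" using assms by (simp add: equilibrium_def)
  show "0 \<le> x i j" if "i < agents M" "j < goods M" for i j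
    using out that by (auto simp: market_outcome_def allocation_def)
  show "0 \<le> p j" if "j < goods M" for j using out that by (simp add: market_outcome_def)
  show "p j \<le> sup_norm (goods M) p" if "j < goods M" for j
    using sup_norm_ge[OF that, of p] by linarith
  show "0 \<le> sup_norm (goods M) p" by (rule sup_norm_nonneg)
  show "p j = 0 \<or> (\<Sum>i<agents M. x i j) = 1" if "j < goods M" for j
    using assms that by (simp add: equilibrium_def)
  show "(\<Sum>j<goods M. x i j * p j) = budget M i" if "i < agents M" for i
    using assms that by (simp add: equilibrium_def)
qed

lemma rounded_equilibrium:
  assumes M: "fisher_market M" "equilibrium M x p"
    and "rounding.result (agents M) (goods M) x p (budget M) (sup_norm (goods M) p) s"
  defines "M' \<equiv> M\<lparr>budget := output_budget s\<rparr>"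
  shows "fisher_market M'" "integral_equilibrium M' (output_allocation M s) p"
    "sup_norm (agents M) (\<lambda>i. output_budget s i - budget M i) \<le> sup_norm (goods M) p"
    "(\<Sum>i<agents M. output_budget s i) = (\<Sum>i<agents M. budget M i)"
proof -
  interpret rounding "agents M" "goods M" x p "budget M" "sup_norm (goods M) p"
    using M(2) by (rule rounding_equilibrium)
  obtain ow where ow: "owned ow" "\<And>i. i < agents M \<Longrightarrow> \<bar>spend ow i - budget M i\<bar> \<le> sup_norm (goods M) p"
    "output_budget s = spend ow"
    and x': "\<And>i j. i < agents M \<Longrightarrow> j < goods M \<Longrightarrow>
      output_allocation M s i j = (if ow j = i then 1 else 0)"
    using assms(3) unfolding result_def output_budget_def[abs_def] output_allocation_def by auto
  have total: "(\<Sum>i<agents M. if ow j = i then c else 0) = (if ow j < agents M then c else 0)"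
    for j and c :: real by simp
  have owner: "ow j < agents M \<and> 0 < x (ow j) j \<or> ow j = agents M \<and> p j = 0" if "j < goods M" for j
    using ow(1) that by (simp add: owned_def)
  have sum_x': "(\<Sum>i<agents M. output_allocation M s i j) = (if ow j < agents M then 1 else 0)"
    if "j < goods M" for j
  proof -
    have "(\<Sum>i<agents M. output_allocation M s i j) = (\<Sum>i<agents M. if ow j = i then 1 else 0)"
      using x' that by (intro sum.cong) auto
    then show ?thesis using total[of j 1] by simp
  qed
  show "fisher_market M'"
    using M(1) p_nonneg unfolding fisher_market_def M'_def ow(3) spend_def
    by (auto intro!: sum_nonneg)
  have alloc: "allocation M' (output_allocation M s)"
    unfolding allocation_def M'_def using x' sum_x' by simp
  have "(\<Sum>g<goods M. output_allocation M s i g * p g) = spend ow i" if "i < agents M" for i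
    unfolding spend_def using x'[OF that] by (intro sum.cong) auto
  moreover have "g \<in> MBB M' p i" if "i < agents M" "g < goods M" "0 < output_allocation M s i g" for i g
  proof -
    have "ow g = i" using x' that by (auto split: if_splits)
    \<comment> \<open>An allotted good was already held in part, and \<open>MBB\<close> does not
      depend on budgets, so optimality carries over.\<close>
    then have "0 < x i g" using owner[OF that(2)] that(1) by auto
    then have "g \<in> MBB M p i" using M(2) that by (simp add: equilibrium_def)
    then show ?thesis by (simp add: MBB_def M'_def)
  qed
  moreover have "p g = 0 \<or> (\<Sum>i<agents M. output_allocation M s i g) = 1" if "g < goods M" for g
    using owner[OF that] sum_x'[OF that] by auto
  ultimately have "equilibrium M' (output_allocation M s) p"
    using alloc p_nonneg unfolding equilibrium_def market_outcome_def
    by (simp add: M'_def ow(3))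
  then show "integral_equilibrium M' (output_allocation M s) p"
    unfolding integral_equilibrium_def integral_allocation_def using alloc x' by (simp add: M'_def)
  show "sup_norm (agents M) (\<lambda>i. output_budget s i - budget M i) \<le> sup_norm (goods M) p"
    using ow(2) by (intro sup_norm_le sup_norm_nonneg) (simp add: ow(3))
  \<comment> \<open>Both totals equal the sum of all prices: goods with positive price are sold
    completely in both allocations, and the others contribute nothing.\<close>
  have "(\<Sum>i<agents M. spend ow i) = (\<Sum>j<goods M. \<Sum>i<agents M. if ow j = i then p j else 0)"
    unfolding spend_def by (rule sum.swap)
  also have "\<dots> = (\<Sum>j<goods M. p j)" using owner by (intro sum.cong) (auto simp: total)
  also have "\<dots> = (\<Sum>j<goods M. \<Sum>i<agents M. x i j * p j)"
    using cleared by (intro sum.cong) (auto simp: sum_distrib_right[symmetric])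
  also have "\<dots> = (\<Sum>i<agents M. \<Sum>j<goods M. x i j * p j)" by (rule sum.swap)
  also have "\<dots> = (\<Sum>i<agents M. budget M i)" using spent by (intro sum.cong) auto
  finally show "(\<Sum>i<agents M. output_budget s i) = (\<Sum>i<agents M. budget M i)" by (simp add: ow(3))
qed

lemma rounding_code_input_state:
  assumes "equilibrium M x p"
  shows "runs rounding_code (input_state M x p) (rounding_time (agents M + goods M))
    (rounding.result (agents M) (goods M) x p (budget M) (sup_norm (goods M) p))"
proof -
  interpret rounding "agents M" "goods M" x p "budget M" "sup_norm (goods M) p"
    using assms by (rule rounding_equilibrium)
  have "i * goods M + j < agents M * goods M" if "i < agents M" "j < goods M" for i j
  proof -
    have "i * goods M + j < Suc i * goods M" using that by simp
    also have "\<dots> \<le> agents M * goods M" using that by (intro mult_le_mono1) simp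
    finally show ?thesis .
  qed
  then have "inputs (input_state M x p)"
    by (simp add: inputs_def input_state_def matrix_array_def vector_array_def)
  moreover have "fresh (input_state M x p)" "blank (input_state M x p)" "rows 0 (input_state M x p)"
    "rmem (input_state M x p) ''P'' 0 = 0"
    by (simp_all add: fresh_def blank_def rows_def input_state_def)
  ultimately show ?thesis by (intro rounding_code_correct) auto
qed

theorem theorem3p1:
  "\<exists>c. solves_in_strongly_polynomial_time c
     {(M, x, p). fisher_market M \<and> equilibrium M x p}
     (\<lambda>(M, x, p). input_state M x p)
     (\<lambda>(M, x, p). agents M + goods M)
     (\<lambda>(M, x, p) s.
        let e' = output_budget s;
            x' = output_allocation M s;
            M' = M\<lparr>budget := e'\<rparr>
        in fisher_market M' \<and>
           integral_equilibrium M' x' p \<and>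
           sup_norm (agents M) (\<lambda>i. e' i - budget M i) \<le> sup_norm (goods M) p \<and>
           (\<Sum>i<agents M. e' i) = (\<Sum>i<agents M. budget M i))"
proof (intro exI additive_solves)
  show "additive rounding_code" by (rule additive_rounding_code)
  show "polynomial rounding_time" by (rule polynomial_rounding_time)
qed (auto simp: finite_cells_input_state Let_def
    intro!: runs_mono[OF rounding_code_input_state order.refl] rounded_equilibrium)

end
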